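(* Let $G$ be a finite simple $4$-connected graph that is not a complete graph. Then $G$ is degree-swappable; that is, for every degree-assignment $L$ of $G$, any two $L$-colorings of $G$ are $L$-equivalent.
   Context: A list-assignment $L$ for a graph $G$ assigns to each vertex $v\in V(G)$ a set (list) of colors $L(v)$. It is a degree-assignment if $|L(v)|\ge d(v)$ for every $v\in V(G)$, where $d(v)$ is the degree of $v$. An $L$-coloring of $G$ is a proper coloring $\varphi$ of $G$ (adjacent vertices receive different colors) with $\varphi(v)\in L(v)$ for every $v$. Given a coloring, a Kempe chain on colors $a$ and $b$ is a connected component of the subgraph induced by the vertices colored $a$ or $b$; a Kempe change is the operation of interchanging the colors $a$ and $b$ on all vertices of one Kempe chain. For an $L$-coloring $\varphi$, a Kempe change is $L$-valid if the resulting coloring is again an $L$-coloring. Two $L$-colorings are $L$-equivalent if one can be obtained from the other by a finite sequence of $L$-valid Kempe changes. A graph $G$ is degree-swappable if for every degree-assignment $L$ of $G$, all $L$-colorings of $G$ are $L$-equivalent. *)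

theory Defs
  imports
    "Graph_Theory.Graph_Theory"
    "HOL-Combinatorics.Transposition"
    "HOL-Library.FuncSet"
begin

text \<open>
  Finite simple graphs are modelled by the locale \<open>graph\<close>: finite, loopless, symmetric digraphs
  without parallel arcs. An undirected edge is a pair of opposite arcs, so the degree of a
  vertex is its \<open>out_degree\<close>.
\<close>

definition k_connected :: "nat \<Rightarrow> ('a, 'b) pre_digraph \<Rightarrow> bool" where
  "k_connected k G \<longleftrightarrow> card (verts G) > k \<and>
     (\<forall>S \<subseteq> verts G. finite S \<and> card S < k \<longrightarrow> Digraph_Component.connected (G \<restriction> (verts G - S)))"

text \<open>The guard \<open>finite (L v)\<close> admits infinite lists, whose \<open>card\<close> is 0 by convention.\<close>

definition degree_assignment :: "('a, 'b) pre_digraph \<Rightarrow> ('a \<Rightarrow> 'c set) \<Rightarrow> bool" where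
  "degree_assignment G L \<longleftrightarrow> (\<forall>v \<in> verts G. finite (L v) \<longrightarrow> card (L v) \<ge> out_degree G v)"

definition proper_coloring :: "('a, 'b) pre_digraph \<Rightarrow> ('a \<Rightarrow> 'c) \<Rightarrow> bool" where
  "proper_coloring G \<phi> \<longleftrightarrow> (\<forall>u v. u \<rightarrow>\<^bsub>G\<^esub> v \<longrightarrow> \<phi> u \<noteq> \<phi> v)"

text \<open>
  Colorings are extensional, i.e. \<open>undefined\<close> outside the vertex set, so that equality of
  functions is equality of colorings.
\<close>

definition L_coloring :: "('a, 'b) pre_digraph \<Rightarrow> ('a \<Rightarrow> 'c set) \<Rightarrow> ('a \<Rightarrow> 'c) \<Rightarrow> bool" where
  "L_coloring G L \<phi> \<longleftrightarrow> \<phi> \<in> (\<Pi>\<^sub>E v \<in> verts G. L v) \<and> proper_coloring G \<phi>"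

text \<open>
  In a symmetric digraph the strongly connected components are the connected components of
  the underlying undirected graph.
\<close>

definition kempe_chain :: "('a, 'b) pre_digraph \<Rightarrow> ('a \<Rightarrow> 'c) \<Rightarrow> 'c \<Rightarrow> 'c \<Rightarrow> 'a set \<Rightarrow> bool" where
  "kempe_chain G \<phi> a b C \<longleftrightarrow>
     C \<in> pre_digraph.sccs_verts (G \<restriction> {v \<in> verts G. \<phi> v = a \<or> \<phi> v = b})"

definition kempe_change :: "('a, 'b) pre_digraph \<Rightarrow> ('a \<Rightarrow> 'c) \<Rightarrow> ('a \<Rightarrow> 'c) \<Rightarrow> bool" where
  "kempe_change G \<phi> \<psi> \<longleftrightarrow> (\<exists>a b C. a \<noteq> b \<and> kempe_chain G \<phi> a b C \<and>
     \<psi> = (\<lambda>v. if v \<in> C then transpose a b (\<phi> v) else \<phi> v))"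

definition L_valid_kempe_change ::
    "('a, 'b) pre_digraph \<Rightarrow> ('a \<Rightarrow> 'c set) \<Rightarrow> ('a \<Rightarrow> 'c) \<Rightarrow> ('a \<Rightarrow> 'c) \<Rightarrow> bool" where
  "L_valid_kempe_change G L \<phi> \<psi> \<longleftrightarrow>
     L_coloring G L \<phi> \<and> kempe_change G \<phi> \<psi> \<and> L_coloring G L \<psi>"

definition L_equivalent ::
    "('a, 'b) pre_digraph \<Rightarrow> ('a \<Rightarrow> 'c set) \<Rightarrow> ('a \<Rightarrow> 'c) \<Rightarrow> ('a \<Rightarrow> 'c) \<Rightarrow> bool" where
  "L_equivalent G L \<phi> \<psi> \<longleftrightarrow> (L_valid_kempe_change G L)\<^sup>*\<^sup>* \<phi> \<psi>"

text \<open>The type argument is the type of colors, which HOL cannot quantify over.\<close>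

definition degree_swappable :: "'c itself \<Rightarrow> ('a, 'b) pre_digraph \<Rightarrow> bool" where
  "degree_swappable _ G \<longleftrightarrow> (\<forall>L :: 'a \<Rightarrow> 'c set. degree_assignment G L \<longrightarrow>
     (\<forall>\<phi> \<psi>. L_coloring G L \<phi> \<longrightarrow> L_coloring G L \<psi> \<longrightarrow> L_equivalent G L \<phi> \<psi>))"

end

theory Submission
  imports Defs
begin

text \<open>
  If some list is larger than the degree of its vertex, delete such a vertex \<open>w\<close>, solve the rest
  inductively (the neighbors of \<open>w\<close> now have a spare color) and lift the swaps: \<open>w\<close> either joins
  the swapped chain or first moves to a spare color. So assume that all lists have exactly the
  size of the degree. Then in every coloring, around every vertex \<open>v\<close>, some neighbor has a color
  outside \<open>L v\<close> (a \<^emph>\<open>single\<close>) or two neighbors have the same color (a \<^emph>\<open>pair\<close>). Fixing the colors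
  of such a pattern and deleting its vertices leaves a connected graph in which \<open>v\<close> has a spare
  color, so all colorings that share a pattern are equivalent, and two patterns that can be
  realized together define the same class. By 4-connectivity, patterns with at most three
  vertices in total can be realized together unless they clash directly.

  If two adjacent vertices have different lists, there is a single. A coloring outside its class
  forbids every pattern compatible with both; this forces all lists but for at most two vertices to
  agree up to two colors, and then either the graph is complete or, as below, a smallest uncolorable
  part is a clique with too few colors. Otherwise all lists agree and the graph is regular. There,
  two disjoint pairs that cannot be realized together leave an uncolorable part; a smallest such
  part is a clique whose vertices each see exactly one vertex of either pair, and a recoloring
  of that clique together with one vertex of a pair gives a coloring in both classes.
\<close>

subsection \<open>List colorings and swaps on unions of Kempe chains\<close>

text \<open>Three precolored vertices leave a connected graph, so one vertex with a spare color is
  enough to color the rest. The obstacle is that two pairs take four vertices: these may separate a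
  4-connected graph, and a component without a spare color may be uncolorable. The later arguments
  study such a component. Since three vertices do not separate, each of the four has a neighbor in
  it. If it is not a clique, two of its vertices at distance two form a new pair, and connectivity
  makes the obstruction belonging to the new pair smaller. In a clique all remaining lists coincide
  and have one color fewer than there are vertices, so any coloring can be compared with them by
  counting. The number 4 also enters as the minimum degree: every list has a color besides the two
  in play, and when all lists agree the clique has at least three vertices, two of which see the
  same vertex of a pair.\<close>

text \<open>
  Swaps act on arbitrary sets that are closed in the subgraph of two colors, i.e. on unions of
  Kempe chains, and colorings of \<open>W\<close> are total functions whose values outside \<open>W\<close> are irrelevant.
  Connectedness is expressed by the absence of proper closed subsets.
\<close>

locale simple_graph =
  fixes V :: "'a set" and E :: "'a \<Rightarrow> 'a \<Rightarrow> bool"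
  assumes finite_V: "finite V"
    and E_V: "E u v \<Longrightarrow> u \<in> V"
    and E_sym: "E u v \<Longrightarrow> E v u"
    and E_irrefl: "\<not> E v v"
begin

lemma E_V2: "E u v \<Longrightarrow> v \<in> V"
  using E_V E_sym by blast

definition nbrs :: "'a set \<Rightarrow> 'a \<Rightarrow> 'a set" where
  "nbrs W v = {u \<in> W. E v u}"

definition closed_in :: "'a set \<Rightarrow> 'a set \<Rightarrow> bool" where
  "closed_in W A \<longleftrightarrow> A \<subseteq> W \<and> (\<forall>a\<in>A. \<forall>b\<in>W - A. \<not> E a b)"

definition connected_on :: "'a set \<Rightarrow> bool" where
  "connected_on W \<longleftrightarrow> (\<forall>A. closed_in W A \<longrightarrow> A = {} \<or> A = W)"

definition clique :: "'a set \<Rightarrow> bool" where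
  "clique W \<longleftrightarrow> (\<forall>u\<in>W. \<forall>v\<in>W. u \<noteq> v \<longrightarrow> E u v)"

definition list_coloring :: "'a set \<Rightarrow> ('a \<Rightarrow> 'c set) \<Rightarrow> ('a \<Rightarrow> 'c) \<Rightarrow> bool" where
  "list_coloring W L \<phi> \<longleftrightarrow> (\<forall>v\<in>W. \<phi> v \<in> L v) \<and> (\<forall>u\<in>W. \<forall>v\<in>W. E u v \<longrightarrow> \<phi> u \<noteq> \<phi> v)"

definition swap_closed :: "'a set \<Rightarrow> ('a \<Rightarrow> 'c) \<Rightarrow> 'c \<Rightarrow> 'c \<Rightarrow> 'a set \<Rightarrow> bool" where
  "swap_closed W \<phi> a b C \<longleftrightarrow> C \<subseteq> {v \<in> W. \<phi> v \<in> {a, b}} \<and>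
     (\<forall>u\<in>C. \<forall>v\<in>W. E u v \<longrightarrow> \<phi> v \<in> {a, b} \<longrightarrow> v \<in> C)"

definition swap :: "'a set \<Rightarrow> ('a \<Rightarrow> 'c set) \<Rightarrow> ('a \<Rightarrow> 'c) \<Rightarrow> ('a \<Rightarrow> 'c) \<Rightarrow> bool" where
  "swap W L \<phi> \<psi> \<longleftrightarrow> list_coloring W L \<phi> \<and> list_coloring W L \<psi> \<and>
     (\<exists>a b C. swap_closed W \<phi> a b C \<and>
       (\<forall>v\<in>W. \<psi> v = (if v \<in> C then transpose a b (\<phi> v) else \<phi> v)))"

abbreviation swap_equiv :: "'a set \<Rightarrow> ('a \<Rightarrow> 'c set) \<Rightarrow> ('a \<Rightarrow> 'c) \<Rightarrow> ('a \<Rightarrow> 'c) \<Rightarrow> bool" where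
  "swap_equiv W L \<equiv> (swap W L)\<^sup>*\<^sup>*"

lemma finite_nbrs: "finite (nbrs W v)"
  by (rule finite_subset[OF _ finite_V]) (auto simp: nbrs_def dest: E_V2)

lemma swap_closedI:
  assumes "\<And>u. u \<in> C \<Longrightarrow> u \<in> W" "\<And>u. u \<in> C \<Longrightarrow> \<phi> u \<in> {a, b}"
    and "\<And>u v. u \<in> C \<Longrightarrow> v \<in> W \<Longrightarrow> E u v \<Longrightarrow> \<phi> v \<in> {a, b} \<Longrightarrow> v \<in> C"
  shows "swap_closed W \<phi> a b C"
  using assms unfolding swap_closed_def by blast

lemma swap_closedD:
  assumes "swap_closed W \<phi> a b C" "u \<in> C"
  shows "u \<in> W" "\<phi> u \<in> {a, b}" "v \<in> W \<Longrightarrow> E u v \<Longrightarrow> \<phi> v \<in> {a, b} \<Longrightarrow> v \<in> C"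
  using assms unfolding swap_closed_def by blast+

lemma list_coloringD:
  assumes "list_coloring W L \<phi>"
  shows "v \<in> W \<Longrightarrow> \<phi> v \<in> L v" "u \<in> W \<Longrightarrow> v \<in> W \<Longrightarrow> E u v \<Longrightarrow> \<phi> u \<noteq> \<phi> v"
  using assms unfolding list_coloring_def by blast+

text \<open>Inside \<open>C\<close> the transposition is injective. Across the border of
  \<open>C\<close> only the inner end has a color in \<open>{a, b}\<close>, before and after the
  exchange.\<close>

lemma list_coloring_swapped:
  assumes "list_coloring W L \<phi>" "swap_closed W \<phi> a b C"
    and "\<And>v. v \<in> W \<Longrightarrow> \<psi> v = (if v \<in> C then transpose a b (\<phi> v) else \<phi> v)"
    and "\<And>v. v \<in> C \<Longrightarrow> transpose a b (\<phi> v) \<in> L v"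
  shows "list_coloring W L \<psi>"
  unfolding list_coloring_def
proof (intro conjI ballI impI)
  fix v assume "v \<in> W" thus "\<psi> v \<in> L v"
    using assms unfolding list_coloring_def by auto
next
  fix u v assume uv: "u \<in> W" "v \<in> W" "E u v"
  have ne: "\<phi> u \<noteq> \<phi> v" using assms(1) uv by (auto simp: list_coloring_def)
  have *: "\<phi> y \<notin> {a,b}" if "x \<in> C" "y \<in> W" "E x y" "y \<notin> C" for x y
    using assms(2) that unfolding swap_closed_def by blast
  have sub: "\<phi> x \<in> {a,b}" if "x \<in> C" for x using assms(2) that unfolding swap_closed_def by blast
  have vu: "E v u" by (rule E_sym[OF uv(3)])
  show "\<psi> u \<noteq> \<psi> v"
  proof (cases "u \<in> C")
    case True
    show ?thesis
    proof (cases "v \<in> C")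
      case True
      thus ?thesis using ne \<open>u \<in> C\<close> by (simp add: assms(3) uv(1,2) inj_eq[OF inj_transpose])
    next
      case False
      have "transpose a b (\<phi> u) \<in> {a,b}" using sub[OF True] by auto
      thus ?thesis using *[OF True uv(2,3) False] True False by (auto simp: assms(3) uv(1,2))
    qed
  next
    case False
    show ?thesis
    proof (cases "v \<in> C")
      case True
      have "transpose a b (\<phi> v) \<in> {a,b}" using sub[OF True] by auto
      thus ?thesis using *[OF True uv(1) vu False] True False by (auto simp: assms(3) uv(1,2))
    qed (use ne False in \<open>simp add: assms(3) uv(1,2)\<close>)
  qed
qed

lemma swapI:
  assumes "list_coloring W L \<phi>" "swap_closed W \<phi> a b C"
    and "\<And>v. v \<in> W \<Longrightarrow> \<psi> v = (if v \<in> C then transpose a b (\<phi> v) else \<phi> v)"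
    and "\<And>v. v \<in> C \<Longrightarrow> transpose a b (\<phi> v) \<in> L v"
  shows "swap W L \<phi> \<psi>"
proof -
  have "list_coloring W L \<psi>" by (rule list_coloring_swapped[OF assms]) auto
  moreover have "\<exists>a b C. swap_closed W \<phi> a b C \<and>
       (\<forall>v\<in>W. \<psi> v = (if v \<in> C then transpose a b (\<phi> v) else \<phi> v))"
    using assms(2,3) by (intro exI[of _ a] exI[of _ b] exI[of _ C]) auto
  ultimately show ?thesis using assms(1) unfolding swap_def by simp
qed

lemma swap_agree:
  assumes "list_coloring W L \<phi>" "\<And>v. v \<in> W \<Longrightarrow> \<phi> v = \<psi> v"
  shows "swap W L \<phi> \<psi>"
  by (rule swapI[OF assms(1), of undefined undefined "{}"]) (auto simp: swap_closed_def assms(2))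

text \<open>The exchange does not change which vertices have a color in \<open>{a, b}\<close>, so
  the same \<open>C\<close> is closed for \<open>\<psi>\<close>, and transposing twice is the
  identity.\<close>

lemma swap_sym: "swap W L \<phi> \<psi> \<Longrightarrow> swap W L \<psi> \<phi>"
proof -
  assume s: "swap W L \<phi> \<psi>"
  then obtain a b C where C: "swap_closed W \<phi> a b C"
    and ps: "\<And>v. v \<in> W \<Longrightarrow> \<psi> v = (if v \<in> C then transpose a b (\<phi> v) else \<phi> v)"
    and l: "list_coloring W L \<phi>" "list_coloring W L \<psi>"
    unfolding swap_def by blast
  have CW: "C \<subseteq> W" using C by (auto simp: swap_closed_def)
  have ab: "\<psi> v \<in> {a,b} \<longleftrightarrow> \<phi> v \<in> {a,b}" if "v \<in> W" for v
  proof (cases "v \<in> C")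
    case True
    hence "\<phi> v \<in> {a,b}" using C unfolding swap_closed_def by blast
    thus ?thesis using ps[OF that] True by auto
  qed (use ps[OF that] in simp)
  have inv: "\<phi> v = (if v \<in> C then transpose a b (\<psi> v) else \<psi> v)" if "v \<in> W" for v
    using ps[OF that] by simp
  show ?thesis
  proof (rule swapI[OF l(2), of a b C])
    show "swap_closed W \<psi> a b C" using C ab CW unfolding swap_closed_def by blast
    show "transpose a b (\<psi> v) \<in> L v" if "v \<in> C" for v
    proof -
      have "v \<in> W" using that CW by auto
      thus ?thesis using inv[of v] that l(1) unfolding list_coloring_def by auto
    qed
  qed (use inv in auto)
qed

lemma swap_equiv_sym: "swap_equiv W L \<phi> \<psi> \<Longrightarrow> swap_equiv W L \<psi> \<phi>"
  by (induction rule: rtranclp_induct) (auto intro: converse_rtranclp_into_rtranclp swap_sym)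

lemma swap_equiv_coloring:
  "swap_equiv W L \<phi> \<psi> \<Longrightarrow> list_coloring W L \<phi> \<Longrightarrow> list_coloring W L \<psi>"
  by (induction rule: rtranclp_induct) (auto simp: swap_def)

text \<open>Neither the old nor the new color of \<open>w\<close> occurs on a neighbor, so
  \<open>{w}\<close> is closed for these two colors.\<close>

lemma swap_recolor:
  assumes "list_coloring W L \<phi>" "list_coloring W L \<psi>" "w \<in> W"
    and "\<And>v. v \<in> W \<Longrightarrow> v \<noteq> w \<Longrightarrow> \<psi> v = \<phi> v"
  shows "swap W L \<phi> \<psi>"
proof (rule swapI[OF assms(1), of "\<phi> w" "\<psi> w" "{w}"])
  show "swap_closed W \<phi> (\<phi> w) (\<psi> w) {w}"
    unfolding swap_closed_def
  proof (intro conjI ballI impI)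
    show "{w} \<subseteq> {v \<in> W. \<phi> v \<in> {\<phi> w, \<psi> w}}" using assms(3) by auto
    fix u v assume uv: "u \<in> {w}" "v \<in> W" "E u v" "\<phi> v \<in> {\<phi> w, \<psi> w}"
    hence "v \<noteq> w" using E_irrefl by auto
    hence "\<psi> v = \<phi> v" using assms(4) uv by auto
    moreover have "\<phi> w \<noteq> \<phi> v" "\<psi> w \<noteq> \<psi> v"
      using assms(1-3) uv unfolding list_coloring_def by auto
    ultimately show "v \<in> {w}" using uv by auto
  qed
qed (use assms in \<open>auto simp: list_coloring_def\<close>)

lemma card_nbrs_diff:
  assumes "X \<subseteq> W"
  shows "card (nbrs W v) = card (nbrs (W - X) v) + card (nbrs X v)"
proof -
  have "nbrs W v = nbrs (W - X) v \<union> nbrs X v" using assms by (auto simp: nbrs_def)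
  moreover have "nbrs (W - X) v \<inter> nbrs X v = {}" by (auto simp: nbrs_def)
  ultimately show ?thesis by (metis card_Un_disjoint finite_nbrs)
qed

lemma nbrs_mono: "X \<subseteq> W \<Longrightarrow> card (nbrs X v) \<le> card (nbrs W v)"
  by (intro card_mono finite_nbrs) (auto simp: nbrs_def)

section \<open>Lists with a spare color in every component\<close>

definition degree_lists :: "'a set \<Rightarrow> ('a \<Rightarrow> 'c set) \<Rightarrow> bool" where
  "degree_lists W L \<longleftrightarrow> (\<forall>v\<in>W. finite (L v) \<and> card (nbrs W v) \<le> card (L v))"

text \<open>Nonempty closed sets are unions of components, so a strict inequality is demanded in
  each component of \<open>W\<close>. This form survives the deletion of a vertex even if it
  disconnects \<open>W\<close>.\<close>

definition surplus_lists :: "'a set \<Rightarrow> ('a \<Rightarrow> 'c set) \<Rightarrow> bool" where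
  "surplus_lists W L \<longleftrightarrow> degree_lists W L \<and>
     (\<forall>A. closed_in W A \<longrightarrow> A \<noteq> {} \<longrightarrow> (\<exists>v\<in>A. card (nbrs W v) < card (L v)))"

text \<open>A closed part that touches \<open>w\<close> has a vertex that loses a neighbor but no
  color; one that does not touch \<open>w\<close> was already closed in \<open>W\<close>.\<close>

lemma surplus_lists_remove:
  assumes "surplus_lists W L" "w \<in> W"
  shows "surplus_lists (W - {w}) L"
  unfolding surplus_lists_def degree_lists_def
proof (intro conjI ballI allI impI)
  have d: "\<And>v. v \<in> W \<Longrightarrow> finite (L v) \<and> card (nbrs W v) \<le> card (L v)"
    using assms unfolding surplus_lists_def degree_lists_def by auto
  { fix v assume "v \<in> W - {w}"
    thus "finite (L v)" "card (nbrs (W - {w}) v) \<le> card (L v)"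
      using d[of v] nbrs_mono[of "W - {w}" W v] by auto }
  fix A assume A: "closed_in (W - {w}) A" "A \<noteq> {}"
  show "\<exists>v\<in>A. card (nbrs (W - {w}) v) < card (L v)"
  proof (cases "\<exists>u\<in>A. E u w")
    case True
    then obtain u where u: "u \<in> A" "E u w" by auto
    have uW: "u \<in> W" using u A by (auto simp: closed_in_def)
    have "nbrs {w} u = {w}" using u by (auto simp: nbrs_def)
    hence "card (nbrs W u) = card (nbrs (W - {w}) u) + 1"
      using card_nbrs_diff[of "{w}" W u] assms(2) by auto
    thus ?thesis using d[OF uW] u by (intro bexI[of _ u]) auto
  next
    case False
    hence "closed_in W A" using A unfolding closed_in_def by blast
    then obtain v where "v \<in> A" "card (nbrs W v) < card (L v)"
      using assms A unfolding surplus_lists_def by blast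
    thus ?thesis using nbrs_mono[of "W - {w}" W v] by (intro bexI[of _ v]) auto
  qed
qed

lemma surplus_lists_obtain:
  assumes "surplus_lists W L" "W \<noteq> {}"
  obtains w where "w \<in> W" "card (nbrs W w) < card (L w)"
proof -
  have "closed_in W W" by (auto simp: closed_in_def)
  thus ?thesis using assms that unfolding surplus_lists_def by blast
qed

text \<open>A vertex with a spare color is colored last: its neighbors cannot exhaust its
  list.\<close>

theorem surplus_colorable:
  assumes "finite W" "surplus_lists W L"
  shows "\<exists>\<phi>. list_coloring W L \<phi>"
  using assms
proof (induction "card W" arbitrary: W)
  case 0
  thus ?case by (auto simp: list_coloring_def)
next
  case (Suc n)
  then have "W \<noteq> {}" by auto
  then obtain w where w: "w \<in> W" "card (nbrs W w) < card (L w)"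
    using surplus_lists_obtain Suc.prems by metis
  obtain \<phi> where p: "list_coloring (W - {w}) L \<phi>"
    using Suc.hyps(1)[of "W - {w}"] Suc.hyps(2) Suc.prems w surplus_lists_remove[OF Suc.prems(2) w(1)]
    by (metis card_Diff_singleton diff_Suc_1 finite_Diff)
  have "card (\<phi> ` nbrs W w) < card (L w)"
    using w(2) card_image_le[OF finite_nbrs, of \<phi> W w] by linarith
  hence "\<not> L w \<subseteq> \<phi> ` nbrs W w"
    using card_mono[of "\<phi> ` nbrs W w" "L w"] finite_nbrs by auto
  then obtain c where c: "c \<in> L w" "c \<notin> \<phi> ` nbrs W w" by auto
  have "list_coloring W L (\<phi>(w := c))"
    using p c E_irrefl E_sym unfolding list_coloring_def nbrs_def by auto
  thus ?case by blast
qed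

text \<open>A swap on \<open>C\<close> fails to be one in \<open>W\<close> only if \<open>w\<close>
  touches \<open>C\<close> and has one of the two colors. The color of \<open>w\<close> has to adapt
  then, which is why the result is controlled off \<open>w\<close> only.\<close>

lemma lift_swap:
  assumes "surplus_lists W L" "w \<in> W" "card (nbrs W w) < card (L w)"
    and st: "swap (W - {w}) L \<phi> \<psi>"
    and l: "list_coloring W L \<chi>" and ag: "\<And>v. v \<in> W - {w} \<Longrightarrow> \<chi> v = \<phi> v"
  shows "\<exists>\<chi>'. swap_equiv W L \<chi> \<chi>' \<and> (\<forall>v\<in>W - {w}. \<chi>' v = \<psi> v)"
proof -
  obtain a b C where C: "swap_closed (W - {w}) \<phi> a b C"
    and ps: "\<And>v. v \<in> W - {w} \<Longrightarrow> \<psi> v = (if v \<in> C then transpose a b (\<phi> v) else \<phi> v)"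
    and lp: "list_coloring (W - {w}) L \<psi>"
    using st unfolding swap_def by blast
  have CW: "C \<subseteq> W - {w}" using C by (auto simp: swap_closed_def)
  have inL: "transpose a b (\<chi> v) \<in> L v" if "v \<in> C" for v
  proof -
    have "v \<in> W - {w}" using that CW by auto
    thus ?thesis using that ps[of v] lp ag[of v] unfolding list_coloring_def by metis
  qed
  have direct: "\<exists>\<chi>''. swap W L \<chi>' \<chi>'' \<and> (\<forall>v\<in>W - {w}. \<chi>'' v = \<psi> v)"
    if l': "list_coloring W L \<chi>'" and ag': "\<And>v. v \<in> W - {w} \<Longrightarrow> \<chi>' v = \<phi> v"
      and nw: "\<chi>' w \<notin> {a,b} \<or> (\<forall>u\<in>C. \<not> E u w)" for \<chi>'
  proof -
    have "swap_closed W \<chi>' a b C"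
    proof (rule swap_closedI)
      fix u assume u: "u \<in> C"
      hence uW: "u \<in> W - {w}" by (rule swap_closedD(1)[OF C])
      thus "u \<in> W" by simp
      show "\<chi>' u \<in> {a,b}" using swap_closedD(2)[OF C u] ag'[OF uW] by simp
      fix v assume v: "v \<in> W" "E u v" "\<chi>' v \<in> {a,b}"
      have "v \<noteq> w" using nw u v by blast
      thus "v \<in> C" using swap_closedD(3)[OF C u, of v] v ag'[of v] by simp
    qed
    moreover have "transpose a b (\<chi>' v) \<in> L v" if "v \<in> C" for v
    proof -
      have "v \<in> W - {w}" using that CW by auto
      thus ?thesis using inL[OF that] ag[of v] ag'[of v] by simp
    qed
    ultimately have "swap W L \<chi>' (\<lambda>v. if v \<in> C then transpose a b (\<chi>' v) else \<chi>' v)"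
      by (intro swapI[OF l']) auto
    moreover have "\<forall>v\<in>W - {w}. (if v \<in> C then transpose a b (\<chi>' v) else \<chi>' v) = \<psi> v"
      using ps ag' by auto
    ultimately show ?thesis by blast
  qed
  show ?thesis
  proof (cases "\<chi> w \<notin> {a,b} \<or> (\<forall>u\<in>C. \<not> E u w)")
    case True
    thus ?thesis using direct[OF l ag] by blast
  next
    case False
    define d where "d = transpose a b (\<chi> w)"
    have ab: "{a,b} = {\<chi> w, d}" "transpose a b = transpose (\<chi> w) d"
      using False unfolding d_def by (auto simp: transpose_commute)
    obtain u0 where u0: "u0 \<in> C" "E u0 w" using False by auto
    have u0W: "u0 \<in> W" "u0 \<noteq> w" using u0 CW by auto
    have u0d: "\<chi> u0 = d"
    proof -
      have "\<chi> u0 \<in> {\<chi> w, d}" using swap_closedD(2)[OF C u0(1)] ab(1) ag[of u0] u0W by simp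
      moreover have "\<chi> u0 \<noteq> \<chi> w" by (rule list_coloringD(2)[OF l u0W(1) assms(2) u0(2)])
      ultimately show ?thesis by auto
    qed

    have u0n: "u0 \<in> nbrs W w" using u0W u0 E_sym by (auto simp: nbrs_def)
    show ?thesis
    proof (cases "d \<in> L w \<and> (\<forall>u\<in>nbrs W w. \<chi> u = d \<longrightarrow> u = u0)")
      case True
      \<comment> \<open>The only neighbor of \<open>w\<close> with the other color \<open>d\<close>
        is \<open>u0\<close>, which lies in \<open>C\<close>, so \<open>C\<close> stays closed when
        \<open>w\<close> joins.\<close>
      define C' where "C' = insert w C"
      have cl: "swap_closed W \<chi> a b C'"
      proof (rule swap_closedI)
        fix u assume u: "u \<in> C'"
        show "u \<in> W" using u assms(2) swap_closedD(1)[OF C, of u] by (auto simp: C'_def)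
        show "\<chi> u \<in> {a,b}"
          using u ab(1) swap_closedD(1,2)[OF C, of u] ag[of u] by (cases "u = w") (auto simp: C'_def)
        fix v assume v: "v \<in> W" "E u v" "\<chi> v \<in> {a,b}"
        show "v \<in> C'"
        proof (cases "v = w")
          case False
          show ?thesis
          proof (cases "u = w")
            case True
            have "\<chi> v \<noteq> \<chi> w" using list_coloringD(2)[OF l assms(2) v(1)] v True by auto
            hence "\<chi> v = d" using v ab by auto
            hence "v = u0" using \<open>d \<in> L w \<and> _\<close> v True by (auto simp: nbrs_def)
            thus ?thesis using u0 by (auto simp: C'_def)
          next
            case False
            hence "u \<in> C" using u by (auto simp: C'_def)
            hence "v \<in> C" using swap_closedD(3)[OF C, of u v] v \<open>v \<noteq> w\<close> ag[of v] by simp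
            thus ?thesis by (simp add: C'_def)
          qed
        qed (simp add: C'_def)
      qed
      have "swap W L \<chi> (\<lambda>v. if v \<in> C' then transpose a b (\<chi> v) else \<chi> v)"
        using inL True by (intro swapI[OF l cl]) (auto simp: C'_def d_def)
      moreover have "\<forall>v\<in>W - {w}. (if v \<in> C' then transpose a b (\<chi> v) else \<chi> v) = \<psi> v"
        using ps ag by (auto simp: C'_def)
      ultimately show ?thesis by blast
    next
      case False
      have fin: "finite (L w)" using assms(1,2) by (auto simp: surplus_lists_def degree_lists_def)
      \<comment> \<open>Here \<open>d\<close> is not in the list of \<open>w\<close> or occurs on
        two neighbors, so the neighbors block fewer colors of the list than their number. The strict
        surplus then leaves a color \<open>e\<close> even after discarding the present one, and
        \<open>e\<close> is not \<open>d\<close> because \<open>u0\<close> has color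
        \<open>d\<close>.\<close>
      let ?N = "nbrs W w" and ?S = "insert (\<chi> w) (\<chi> ` (nbrs W w) \<inter> L w)"
      have less: "card (\<chi> ` ?N \<inter> L w) < card ?N" if "\<chi> ` ?N \<inter> L w \<subseteq> \<chi> ` (?N - {u0})"
      proof -
        have "card (\<chi> ` ?N \<inter> L w) \<le> card (\<chi> ` (?N - {u0}))"
          by (rule card_mono[OF _ that]) (simp add: finite_nbrs)
        also have "\<dots> \<le> card (?N - {u0})" by (rule card_image_le) (simp add: finite_nbrs)
        also have "\<dots> < card ?N" by (rule card_Diff1_less[OF finite_nbrs u0n])
        finally show ?thesis .
      qed
      have "card (\<chi> ` ?N \<inter> L w) < card ?N"
      proof (cases "d \<in> L w")
        case False
        have "\<chi> ` ?N \<inter> L w \<subseteq> \<chi> ` (?N - {u0})" using False u0d by auto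
        thus ?thesis by (rule less)
      next
        case True
        then obtain u1 where u1: "u1 \<in> ?N" "\<chi> u1 = d" "u1 \<noteq> u0"
          using \<open>\<not> (d \<in> L w \<and> _)\<close> by auto
        have "\<chi> u0 \<in> \<chi> ` (?N - {u0})" using u1 u0d by (intro image_eqI[of _ _ u1]) auto
        hence "\<chi> ` ?N \<inter> L w \<subseteq> \<chi> ` (?N - {u0})" by auto
        thus ?thesis by (rule less)
      qed
      moreover have "card ?S \<le> Suc (card (\<chi> ` ?N \<inter> L w))" by (simp add: card_insert_if fin)
      ultimately have "card ?S < card (L w)" using assms(3) by linarith
      hence "\<not> L w \<subseteq> ?S" using fin card_mono[of ?S "L w"] by auto
      then obtain e where e: "e \<in> L w" "e \<noteq> \<chi> w" "e \<notin> \<chi> ` ?N" by auto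
      have ed: "e \<noteq> d" using e u0n u0d by auto
      have l': "list_coloring W L (\<chi>(w := e))"
        using l e E_irrefl E_sym unfolding list_coloring_def nbrs_def by auto
      have s: "swap W L \<chi> (\<chi>(w := e))" by (rule swap_recolor[OF l l' assms(2)]) auto
      have "(\<chi>(w := e)) w \<notin> {a,b}" using ed e ab(1) by auto
      then obtain \<chi>'' where "swap W L (\<chi>(w := e)) \<chi>''" "\<forall>v\<in>W - {w}. \<chi>'' v = \<psi> v"
        using direct[OF l'] ag by (metis DiffD2 fun_upd_other singletonI)
      with s show ?thesis by (meson rtranclp.rtrancl_into_rtrancl rtranclp.rtrancl_refl)
    qed
  qed
qed

theorem surplus_equiv:
  assumes "finite W" "surplus_lists W L" "list_coloring W L \<phi>" "list_coloring W L \<psi>"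
  shows "swap_equiv W L \<phi> \<psi>"
  using assms
proof (induction "card W" arbitrary: W)
  case 0
  hence "swap W L \<phi> \<psi>" by (intro swap_agree) auto
  thus ?case by blast
next
  case (Suc n)
  then have "W \<noteq> {}" by auto
  then obtain w where w: "w \<in> W" "card (nbrs W w) < card (L w)"
    using surplus_lists_obtain Suc.prems by metis
  have eq: "swap_equiv (W - {w}) L \<phi> \<psi>"
  proof (rule Suc.hyps(1))
    show "n = card (W - {w})" using Suc.hyps(2) Suc.prems(1) w by simp
    show "surplus_lists (W - {w}) L" by (rule surplus_lists_remove[OF Suc.prems(2) w(1)])
  qed (use Suc.prems in \<open>auto simp: list_coloring_def\<close>)
  have "\<exists>\<chi>. swap_equiv W L \<phi> \<chi> \<and> (\<forall>v\<in>W - {w}. \<chi> v = \<psi> v)"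
    using eq
  proof (induction rule: rtranclp_induct)
    case base
    show ?case by blast
  next
    case (step \<psi>1 \<psi>2)
    then obtain \<chi> where c: "swap_equiv W L \<phi> \<chi>" "\<forall>v\<in>W - {w}. \<chi> v = \<psi>1 v" by blast
    have "list_coloring W L \<chi>" using swap_equiv_coloring c(1) Suc.prems(3) by blast
    then obtain \<chi>' where "swap_equiv W L \<chi> \<chi>'" "\<forall>v\<in>W - {w}. \<chi>' v = \<psi>2 v"
      using lift_swap[OF Suc.prems(2) w step.hyps(2)] c(2) by blast
    thus ?case using c(1) by (meson rtranclp_trans)
  qed
  then obtain \<chi> where c: "swap_equiv W L \<phi> \<chi>" "\<forall>v\<in>W - {w}. \<chi> v = \<psi> v" by blast
  have "list_coloring W L \<chi>" using swap_equiv_coloring c(1) Suc.prems(3) by blast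
  \<comment> \<open>The lifted sequence reaches \<open>\<psi>\<close> except possibly at
    \<open>w\<close>, where one recoloring finishes.\<close>
  hence "swap W L \<chi> \<psi>" using swap_recolor[OF _ Suc.prems(4) w(1)] c(2) by auto
  with c(1) show ?case by (meson rtranclp.rtrancl_into_rtrancl)
qed

lemma swap_mono_lists:
  assumes "\<And>v. v \<in> W \<Longrightarrow> L' v \<subseteq> L v" "swap W L' \<phi> \<psi>" shows "swap W L \<phi> \<psi>"
proof -
  have "list_coloring W L \<chi>" if "list_coloring W L' \<chi>" for \<chi>
    using that assms(1) unfolding list_coloring_def by blast
  thus ?thesis using assms(2) unfolding swap_def by metis
qed

subsection \<open>Extending precolorings\<close>

definition reduced :: "('a \<Rightarrow> 'c set) \<Rightarrow> 'a set \<Rightarrow> ('a \<Rightarrow> 'c) \<Rightarrow> 'a \<Rightarrow> 'c set" where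
  "reduced L X f v = L v - f ` nbrs X v"

text \<open>The two ways in which colored neighbors take away fewer colors than neighbors, so that
  \<open>v\<close> gains a spare color in the reduced lists.\<close>

definition defect :: "('a \<Rightarrow> 'c set) \<Rightarrow> 'a set \<Rightarrow> ('a \<Rightarrow> 'c) \<Rightarrow> 'a \<Rightarrow> bool" where
  "defect L X f v \<longleftrightarrow> (\<exists>x\<in>X. E v x \<and> f x \<notin> L v) \<or>
     (\<exists>x\<in>X. \<exists>y\<in>X. x \<noteq> y \<and> E v x \<and> E v y \<and> f x = f y)"

lemma defectI1: "x \<in> X \<Longrightarrow> E v x \<Longrightarrow> f x \<notin> L v \<Longrightarrow> defect L X f v"
  unfolding defect_def by blast

lemma defectI2: "x \<in> X \<Longrightarrow> y \<in> X \<Longrightarrow> x \<noteq> y \<Longrightarrow> E v x \<Longrightarrow> E v y \<Longrightarrow> f x = f y \<Longrightarrow> defect L X f v"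
  unfolding defect_def by blast

lemma list_coloringI:
  assumes "\<And>v. v \<in> W \<Longrightarrow> \<phi> v \<in> L v" "\<And>u v. u \<in> W \<Longrightarrow> v \<in> W \<Longrightarrow> E u v \<Longrightarrow> \<phi> u \<noteq> \<phi> v"
  shows "list_coloring W L \<phi>"
  using assms unfolding list_coloring_def by blast

lemma card_reduced_ge:
  assumes "finite (L v)" "card (nbrs W v) \<le> card (L v)" "X \<subseteq> W"
  shows "card (nbrs (W - X) v) \<le> card (reduced L X f v)"
    and "defect L X f v \<Longrightarrow> card (nbrs (W - X) v) < card (reduced L X f v)"
proof -
  let ?I = "L v \<inter> f ` nbrs X v"
  have r: "card (reduced L X f v) = card (L v) - card ?I"
    unfolding reduced_def by (rule card_Diff_subset_Int) (simp add: finite_nbrs)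
  have i: "card ?I \<le> card (f ` nbrs X v)" by (intro card_mono) (auto simp: finite_nbrs)
  have j: "card (f ` nbrs X v) \<le> card (nbrs X v)" by (rule card_image_le[OF finite_nbrs])
  have d: "card (nbrs W v) = card (nbrs (W - X) v) + card (nbrs X v)"
    by (rule card_nbrs_diff[OF assms(3)])
  show "card (nbrs (W - X) v) \<le> card (reduced L X f v)"
    using r i j d assms(2) by linarith
  assume def: "defect L X f v"
  have "card ?I < card (nbrs X v)"
  proof (cases "\<exists>x\<in>X. E v x \<and> f x \<notin> L v")
    case True
    then obtain x where "x \<in> nbrs X v" "f x \<notin> L v" unfolding nbrs_def by auto
    hence "?I \<subset> f ` nbrs X v" by blast
    hence "card ?I < card (f ` nbrs X v)" by (rule psubset_card_mono[rotated]) (simp add: finite_nbrs)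
    thus ?thesis using j by simp
  next
    case False
    then obtain x y where "x \<in> X" "y \<in> X" "x \<noteq> y" "E v x" "E v y" "f x = f y"
      using def unfolding defect_def by blast
    hence "\<not> inj_on f (nbrs X v)" unfolding inj_on_def nbrs_def by blast
    hence "card (f ` nbrs X v) \<noteq> card (nbrs X v)" using eq_card_imp_inj_on[OF finite_nbrs] by blast
    thus ?thesis using i j by simp
  qed
  thus "card (nbrs (W - X) v) < card (reduced L X f v)"
    using r d assms(2) by linarith
qed

lemma glue_coloring:
  assumes "list_coloring X L f" "list_coloring (W - X) (reduced L X f) g"
  shows "list_coloring W L (\<lambda>v. if v \<in> X then f v else g v)"
proof (rule list_coloringI)
  have cross: "g v \<noteq> f u" if "u \<in> X" "v \<in> W - X" "E v u" for u v
  proof -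
    have "f u \<in> f ` nbrs X v" using that by (auto simp: nbrs_def)
    moreover have "g v \<notin> f ` nbrs X v"
      using list_coloringD(1)[OF assms(2) that(2)] by (simp add: reduced_def)
    ultimately show ?thesis by metis
  qed
  fix v assume v: "v \<in> W"
  show "(if v \<in> X then f v else g v) \<in> L v"
    using v list_coloringD(1)[OF assms(1), of v] list_coloringD(1)[OF assms(2), of v]
    by (simp add: reduced_def)
  fix u assume u: "u \<in> W" "E v u"
  show "(if v \<in> X then f v else g v) \<noteq> (if u \<in> X then f u else g u)"
    using v u list_coloringD(2)[OF assms(1), of v u] list_coloringD(2)[OF assms(2), of v u]
      cross[of u v] cross[of v u] E_sym[OF u(2)] by (auto split: if_splits)
qed

lemma reduced_coloring:
  assumes "list_coloring W L \<phi>" "X \<subseteq> W" "\<And>x. x \<in> X \<Longrightarrow> \<phi> x = f x"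
  shows "list_coloring (W - X) (reduced L X f) \<phi>"
proof (rule list_coloringI)
  fix v assume v: "v \<in> W - X"
  have "\<phi> v \<noteq> f x" if "x \<in> nbrs X v" for x
    using list_coloringD(2)[OF assms(1), of v x] that v assms(2,3) by (auto simp: nbrs_def)
  thus "\<phi> v \<in> reduced L X f v"
    using list_coloringD(1)[OF assms(1), of v] v unfolding reduced_def by blast
qed (use list_coloringD(2)[OF assms(1)] in blast)

text \<open>A vertex of \<open>C\<close> has the colors \<open>a\<close> and \<open>b\<close> before
  and after the swap in some order, and both lie in its reduced list. Hence no neighbor in
  \<open>X\<close> has either color, and \<open>C\<close> remains closed in
  \<open>W\<close>.\<close>

lemma swap_glue:
  assumes f: "list_coloring X L f" and X: "X \<subseteq> W"
    and s: "swap (W - X) (reduced L X f) \<phi> \<psi>"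
  shows "swap W L (\<lambda>v. if v \<in> X then f v else \<phi> v) (\<lambda>v. if v \<in> X then f v else \<psi> v)"
proof -
  obtain a b C where C: "swap_closed (W - X) \<phi> a b C"
    and ps: "\<And>v. v \<in> W - X \<Longrightarrow> \<psi> v = (if v \<in> C then transpose a b (\<phi> v) else \<phi> v)"
    and l: "list_coloring (W - X) (reduced L X f) \<phi>" "list_coloring (W - X) (reduced L X f) \<psi>"
    using s unfolding swap_def by blast
  let ?\<phi> = "\<lambda>v. if v \<in> X then f v else \<phi> v"
  have avoid: "f x \<notin> {a, b}" if u: "u \<in> C" and x: "x \<in> X" "E u x" for u x
  proof
    assume fx: "f x \<in> {a, b}"
    have uW: "u \<in> W - X" by (rule swap_closedD(1)[OF C u])
    have "f x \<in> f ` nbrs X u" using x by (auto simp: nbrs_def)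
    hence "\<phi> u \<noteq> f x" "\<psi> u \<noteq> f x"
      using list_coloringD(1)[OF l(1) uW] list_coloringD(1)[OF l(2) uW] by (auto simp: reduced_def)
    thus False using fx swap_closedD(2)[OF C u] ps[OF uW] u by auto
  qed
  have cl: "swap_closed W ?\<phi> a b C"
  proof (rule swap_closedI)
    fix u assume u: "u \<in> C"
    have uW: "u \<in> W - X" by (rule swap_closedD(1)[OF C u])
    thus "u \<in> W" by simp
    show "?\<phi> u \<in> {a, b}" using uW swap_closedD(2)[OF C u] by simp
    fix v assume v: "v \<in> W" "E u v" "?\<phi> v \<in> {a, b}"
    show "v \<in> C"
    proof (cases "v \<in> X")
      case True
      thus ?thesis using avoid[OF u True v(2)] v(3) by simp
    next
      case False
      thus ?thesis using swap_closedD(3)[OF C u, of v] v by simp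
    qed
  qed
  have li: "transpose a b (?\<phi> v) \<in> L v" if "v \<in> C" for v
  proof -
    have "v \<in> W - X" by (rule swap_closedD(1)[OF C that])
    thus ?thesis using ps[of v] that list_coloringD(1)[OF l(2), of v] by (simp add: reduced_def)
  qed
  have eq: "(if v \<in> X then f v else \<psi> v) = (if v \<in> C then transpose a b (?\<phi> v) else ?\<phi> v)"
    if "v \<in> W" for v
    using that ps[of v] swap_closedD(1)[OF C, of v] by auto
  show ?thesis by (rule swapI[OF glue_coloring[OF f l(1)] cl eq li])
qed

lemma swap_equiv_glue:
  assumes f: "list_coloring X L f" and X: "X \<subseteq> W"
    and s: "swap_equiv (W - X) (reduced L X f) \<phi> \<psi>"
  shows "swap_equiv W L (\<lambda>v. if v \<in> X then f v else \<phi> v) (\<lambda>v. if v \<in> X then f v else \<psi> v)"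
  using s by (induction rule: rtranclp_induct) (auto intro: rtranclp.rtrancl_into_rtrancl swap_glue[OF f X])

text \<open>A defect in every component gives the reduced lists a surplus on \<open>W - X\<close>;
  colorings and swaps found there are glued to \<open>f\<close>.\<close>

lemma precoloring:
  assumes "finite W" "degree_lists W L" and X: "X \<subseteq> W" and f: "list_coloring X L f"
    and def: "\<And>A. closed_in (W - X) A \<Longrightarrow> A \<noteq> {} \<Longrightarrow> \<exists>v\<in>A. defect L X f v"
  shows precoloring_extends: "\<exists>\<phi>. list_coloring W L \<phi> \<and> (\<forall>x\<in>X. \<phi> x = f x)"
    and precoloring_equiv: "list_coloring W L \<phi> \<Longrightarrow> list_coloring W L \<psi> \<Longrightarrow>
      (\<And>x. x \<in> X \<Longrightarrow> \<phi> x = f x) \<Longrightarrow> (\<And>x. x \<in> X \<Longrightarrow> \<psi> x = f x) \<Longrightarrow> swap_equiv W L \<phi> \<psi>"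
proof -
  have dl: "finite (L v)" "card (nbrs W v) \<le> card (L v)" if "v \<in> W" for v
    using assms(2) that unfolding degree_lists_def by auto
  have sur: "surplus_lists (W - X) (reduced L X f)"
    unfolding surplus_lists_def degree_lists_def
  proof (intro conjI ballI allI impI)
    fix v assume "v \<in> W - X"
    hence v: "v \<in> W" by simp
    thus "finite (reduced L X f v)" using dl(1)[of v] by (simp add: reduced_def)
    show "card (nbrs (W - X) v) \<le> card (reduced L X f v)" by (rule card_reduced_ge(1)[of L v W X, OF dl(1)[OF v] dl(2)[OF v] X])
  next
    fix A assume A: "closed_in (W - X) A" "A \<noteq> {}"
    then obtain v where "v \<in> A" "defect L X f v" using def by blast
    moreover have v: "v \<in> W" using \<open>v \<in> A\<close> A by (auto simp: closed_in_def)
    ultimately show "\<exists>v\<in>A. card (nbrs (W - X) v) < card (reduced L X f v)"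
      using card_reduced_ge(2)[of L v W X, OF dl(1)[OF v] dl(2)[OF v] X] by blast
  qed
  have fin: "finite (W - X)" using assms(1) by simp
  obtain g where "list_coloring (W - X) (reduced L X f) g" using surplus_colorable[OF fin sur] by blast
  hence "list_coloring W L (\<lambda>v. if v \<in> X then f v else g v)" by (rule glue_coloring[OF f])
  thus "\<exists>\<phi>. list_coloring W L \<phi> \<and> (\<forall>x\<in>X. \<phi> x = f x)" by force
  assume c: "list_coloring W L \<phi>" "list_coloring W L \<psi>"
    and a: "\<And>x. x \<in> X \<Longrightarrow> \<phi> x = f x" "\<And>x. x \<in> X \<Longrightarrow> \<psi> x = f x"
  have "swap_equiv (W - X) (reduced L X f) \<phi> \<psi>"
    by (rule surplus_equiv[OF fin sur reduced_coloring[OF c(1) X a(1)] reduced_coloring[OF c(2) X a(2)]])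
  from swap_equiv_glue[OF f X this]
  have "swap_equiv W L (\<lambda>v. if v \<in> X then f v else \<phi> v) (\<lambda>v. if v \<in> X then f v else \<psi> v)" .
  moreover have "(\<lambda>v. if v \<in> X then f v else \<phi> v) = \<phi>" "(\<lambda>v. if v \<in> X then f v else \<psi> v) = \<psi>"
    using a by (auto simp: fun_eq_iff)
  ultimately show "swap_equiv W L \<phi> \<psi>" by simp
qed

lemma connected_onD:
  assumes "connected_on W" "A \<subseteq> W" "A \<noteq> {}" "A \<noteq> W"
  obtains a b where "a \<in> A" "b \<in> W" "b \<notin> A" "E a b"
  using assms unfolding connected_on_def closed_in_def by blast

text \<open>Connectivity yields an edge leaving the closed neighborhood of a vertex \<open>x\<close>
  that misses some other vertex; it continues an edge at \<open>x\<close>.\<close>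

lemma induced_path:
  assumes "connected_on W" "\<not> clique W"
  obtains x w z where "x \<in> W" "w \<in> W" "z \<in> W" "E x w" "E z w" "x \<noteq> z" "\<not> E x z"
proof -
  obtain x y where xy: "x \<in> W" "y \<in> W" "x \<noteq> y" "\<not> E x y" using assms(2) unfolding clique_def by blast
  let ?A = "insert x (nbrs W x)"
  have "?A \<subseteq> W" "?A \<noteq> {}" "?A \<noteq> W" using xy by (auto simp: nbrs_def)
  then obtain a b where ab: "a \<in> ?A" "b \<in> W" "b \<notin> ?A" "E a b" by (rule connected_onD[OF assms(1)])
  have "\<not> E x b" "x \<noteq> b" using ab by (auto simp: nbrs_def)
  moreover have "a \<in> W" "E x a" using ab calculation by (auto simp: nbrs_def xy)
  ultimately show ?thesis using that[of x a b] xy(1) ab E_sym by blast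
qed

end

subsection \<open>Colorings with repeated or missing colors around a vertex\<close>

locale four_connected = simple_graph +
  assumes card_V: "card V > 4"
    and conn: "X \<subseteq> V \<Longrightarrow> card X < 4 \<Longrightarrow> connected_on (V - X)"
    and not_clique: "\<not> clique V"
begin

text \<open>Fewer than four neighbors could be deleted, which would isolate \<open>v\<close> and
  leave no other vertex, contrary to \<open>card_V\<close>.\<close>

lemma degree_ge: assumes "v \<in> V" shows "card (nbrs V v) \<ge> 4"
proof (rule ccontr)
  assume "\<not> ?thesis"
  hence lt: "card (nbrs V v) < 4" by simp
  have sub: "nbrs V v \<subseteq> V" by (auto simp: nbrs_def)
  have c: "connected_on (V - nbrs V v)" by (rule conn[OF sub lt])
  have "closed_in (V - nbrs V v) {v}" using assms E_irrefl by (auto simp: closed_in_def nbrs_def)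
  hence "V - nbrs V v = {v}" using c unfolding connected_on_def by blast
  hence "V = insert v (nbrs V v)" using sub assms by auto
  hence "card V = card (insert v (nbrs V v))" by simp
  hence "card V \<le> Suc (card (nbrs V v))" by (simp add: card_insert_if finite_nbrs split: if_splits)
  thus False using lt card_V by linarith
qed

end

locale tight_lists = four_connected +
  fixes L :: "'a \<Rightarrow> 'c set"
  assumes finite_L: "v \<in> V \<Longrightarrow> finite (L v)"
    and card_L: "v \<in> V \<Longrightarrow> card (L v) = card (nbrs V v)"
begin

abbreviation col :: "('a \<Rightarrow> 'c) \<Rightarrow> bool" where "col \<equiv> list_coloring V L"
abbreviation equivalent :: "('a \<Rightarrow> 'c) \<Rightarrow> ('a \<Rightarrow> 'c) \<Rightarrow> bool" (infix "\<approx>" 50) where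
  "\<phi> \<approx> \<psi> \<equiv> swap_equiv V L \<phi> \<psi>"

lemma degree_lists_L: "degree_lists V L"
  using finite_L card_L unfolding degree_lists_def by simp

text \<open>With at most three colored vertices \<open>V - X\<close> is connected, so one defect
  serves the whole rest.\<close>

definition good :: "'a set \<Rightarrow> ('a \<Rightarrow> 'c) \<Rightarrow> bool" where
  "good X f \<longleftrightarrow> X \<subseteq> V \<and> card X < 4 \<and> list_coloring X L f \<and> (\<exists>v\<in>V - X. defect L X f v)"

lemma goodI:
  "X \<subseteq> V \<Longrightarrow> card X < 4 \<Longrightarrow> list_coloring X L f \<Longrightarrow> \<exists>v\<in>V - X. defect L X f v \<Longrightarrow> good X f"
  unfolding good_def by simp

lemma good_extends:
  assumes "good X f" shows "\<exists>\<phi>. col \<phi> \<and> (\<forall>x\<in>X. \<phi> x = f x)"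
proof (rule precoloring_extends[OF finite_V degree_lists_L])
  fix A assume "closed_in (V - X) A" "A \<noteq> {}"
  hence "A = V - X" using conn assms unfolding good_def connected_on_def by blast
  thus "\<exists>v\<in>A. defect L X f v" using assms unfolding good_def by blast
qed (use assms in \<open>auto simp: good_def\<close>)

lemma good_equiv:
  assumes "good X f" "col \<phi>" "col \<psi>" "\<And>x. x \<in> X \<Longrightarrow> \<phi> x = f x" "\<And>x. x \<in> X \<Longrightarrow> \<psi> x = f x"
  shows "\<phi> \<approx> \<psi>"
proof (rule precoloring_equiv[OF finite_V degree_lists_L])
  fix A assume "closed_in (V - X) A" "A \<noteq> {}"
  hence "A = V - X" using conn assms unfolding good_def connected_on_def by blast
  thus "\<exists>v\<in>A. defect L X f v" using assms unfolding good_def by blast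
qed (use assms in \<open>auto simp: good_def\<close>)

definition single :: "'a \<Rightarrow> 'c \<Rightarrow> 'a \<Rightarrow> bool" where
  "single u c v \<longleftrightarrow> E u v \<and> c \<in> L u \<and> c \<notin> L v"

definition pair :: "'a \<Rightarrow> 'a \<Rightarrow> 'c \<Rightarrow> 'a \<Rightarrow> bool" where
  "pair x y c v \<longleftrightarrow> E x v \<and> E y v \<and> x \<noteq> y \<and> \<not> E x y \<and> c \<in> L x \<and> c \<in> L y"

text \<open>Pigeonhole: if all neighbors have colors in \<open>L v\<close>, they avoid the color of
  \<open>v\<close> itself, so one color fewer is available than there are neighbors. The membership
  in \<open>L v\<close> recorded for a pair later separates its color from that of a single at
  \<open>v\<close>.\<close>

lemma exists_pattern:
  assumes "col \<phi>" "v \<in> V"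
  obtains (single) x where "single x (\<phi> x) v"
    | (pair) x y where "pair x y (\<phi> x) v" "\<phi> y = \<phi> x" "\<phi> x \<in> L v"
proof -
  have inL: "x \<in> V \<Longrightarrow> \<phi> x \<in> L x" for x by (rule list_coloringD(1)[OF assms(1)])
  have proper: "E x y \<Longrightarrow> \<phi> x \<noteq> \<phi> y" for x y using list_coloringD(2)[OF assms(1)] E_V E_V2 by blast
  show ?thesis
  proof (cases "\<exists>x\<in>nbrs V v. \<phi> x \<notin> L v")
    case True
    then obtain x where "x \<in> V" "E v x" "\<phi> x \<notin> L v" by (auto simp: nbrs_def)
    thus ?thesis using that(1)[of x] inL E_sym by (auto simp: single_def)
  next
    case False
    have sub: "\<phi> ` nbrs V v \<subseteq> L v - {\<phi> v}"
    proof (rule image_subsetI)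
      fix x assume x: "x \<in> nbrs V v"
      hence "\<phi> v \<noteq> \<phi> x" by (intro proper) (simp add: nbrs_def)
      thus "\<phi> x \<in> L v - {\<phi> v}" using False x by simp
    qed
    have "card (\<phi> ` nbrs V v) \<le> card (L v - {\<phi> v})"
      by (rule card_mono[OF _ sub]) (simp add: finite_L assms)
    also have "\<dots> < card (L v)" using finite_L inL assms(2) by (intro card_Diff1_less) auto
    finally have "card (\<phi> ` nbrs V v) < card (nbrs V v)" using card_L[OF assms(2)] by simp
    hence "\<not> inj_on \<phi> (nbrs V v)" using card_image by fastforce
    then obtain x y where xy: "x \<in> nbrs V v" "y \<in> nbrs V v" "x \<noteq> y" "\<phi> x = \<phi> y"
      unfolding inj_on_def by blast
    have "\<not> E x y" using proper[of x y] xy(4) by blast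
    moreover have "x \<in> V" "y \<in> V" "E x v" "E y v" using xy E_sym by (auto simp: nbrs_def)
    moreover have "\<phi> x \<in> L x" "\<phi> x \<in> L y" using inL calculation(2,3) xy(4) by metis+
    ultimately have "pair x y (\<phi> x) v" unfolding pair_def using xy(3) by blast
    thus ?thesis by (rule that(2)) (use xy False in metis)+
  qed
qed

lemma singleD: "single u c v \<Longrightarrow> u \<in> V \<and> v \<in> V \<and> u \<noteq> v \<and> E u v \<and> E v u \<and> c \<in> L u \<and> c \<notin> L v"
  unfolding single_def using E_V E_V2 E_sym E_irrefl by blast

lemma pairD: "pair x y c v \<Longrightarrow> x \<in> V \<and> y \<in> V \<and> v \<in> V \<and> x \<noteq> v \<and> y \<noteq> v \<and> E x v \<and> E y v \<and> E v x \<and> E v y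
    \<and> x \<noteq> y \<and> \<not> E x y \<and> \<not> E y x \<and> c \<in> L x \<and> c \<in> L y"
  unfolding pair_def using E_V E_V2 E_sym E_irrefl by blast

lemma pair_sym: "pair x y c v \<Longrightarrow> pair y x c v"
  unfolding pair_def using E_sym by blast

lemma card_le3: "card {a} < 4" "card {a, b} < 4" "card {a, b, c} < 4"
  by (auto simp: card_insert_if)

lemma single_equiv:
  assumes "single u c v" "col \<phi>" "col \<psi>" "\<phi> u = c" "\<psi> u = c"
  shows "\<phi> \<approx> \<psi>"
proof (rule good_equiv[of "{u}" "\<lambda>_. c"])
  show "good {u} (\<lambda>_. c)"
    using singleD[OF assms(1)] E_irrefl unfolding good_def list_coloring_def defect_def
    by (auto intro: bexI[of _ v])
qed (use assms in auto)

lemma pair_good: assumes "pair x y c v" shows "good {x, y} (\<lambda>_. c)"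
proof -
  have "list_coloring {x,y} L (\<lambda>_. c)"
    using pairD[OF assms] E_irrefl by (auto simp: list_coloring_def)
  moreover have "defect L {x,y} (\<lambda>_. c) v" using pairD[OF assms] unfolding defect_def by blast
  ultimately show ?thesis using pairD[OF assms] unfolding good_def by (auto simp: card_insert_if)
qed

lemma pair_equiv:
  assumes "pair x y c v" "col \<phi>" "col \<psi>" "\<phi> x = c" "\<phi> y = c" "\<psi> x = c" "\<psi> y = c"
  shows "\<phi> \<approx> \<psi>"
  by (rule good_equiv[OF pair_good[OF assms(1)]]) (use assms in auto)

text \<open>Three vertices are colored, and \<open>v\<close> stays uncolored because it supplies the
  defect.\<close>

lemma pair_extends: 
  assumes "pair x y c v" "z \<in> V" "z \<noteq> x" "z \<noteq> y" "z \<noteq> v" "d \<in> L z" "d \<noteq> c \<or> (\<not> E z x \<and> \<not> E z y)"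
  obtains \<phi> where "col \<phi>" "\<phi> x = c" "\<phi> y = c" "\<phi> z = d"
proof -
  note p = pairD[OF assms(1)]
  let ?f = "(\<lambda>_. c)(z := d)"
  have zz: "E x z \<longleftrightarrow> E z x" "E y z \<longleftrightarrow> E z y" using E_sym by blast+
  have "list_coloring {x,y,z} L ?f"
    using p E_irrefl assms zz by (auto simp: list_coloring_def)
  moreover have "defect L {x,y,z} ?f v"
    by (rule defectI2[of x _ y]) (use p assms in auto)
  moreover have "v \<in> V - {x,y,z}" using p assms by auto
  ultimately have "good {x,y,z} ?f" using p assms(2) by (intro goodI card_le3) auto
  from good_extends[OF this] obtain \<phi> where "col \<phi>" "\<forall>u\<in>{x,y,z}. \<phi> u = ?f u" by blast
  thus ?thesis using that[of \<phi>] assms(3,4) by auto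
qed

text \<open>A coloring with both singles mediates. The disjunction on colors makes the common
  precoloring proper; the one on vertices leaves a defect uncolored, namely \<open>v\<close>, or
  \<open>w\<close> if \<open>x\<close> occupies \<open>v\<close>.\<close>

lemma link_single_single:
  assumes "single u c v" "single x d w" "u \<noteq> x" "c \<noteq> d \<or> \<not> E u x" "x \<noteq> v \<or> w \<noteq> u"
    and "col \<phi>" "col \<psi>" "\<phi> u = c" "\<psi> x = d"
  shows "\<phi> \<approx> \<psi>"
proof -
  note s = singleD[OF assms(1)] singleD[OF assms(2)]
  have xu: "E x u \<longleftrightarrow> E u x" using E_sym by blast
  let ?f = "(\<lambda>_. c)(x := d)"
  have "list_coloring {u,x} L ?f"
    using s E_irrefl assms xu by (auto simp: list_coloring_def)
  moreover have "\<exists>y\<in>V - {u,x}. defect L {u,x} ?f y"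
  proof (cases "x = v")
    case False
    have "defect L {u,x} ?f v" by (rule defectI1[of u]) (use s assms(3) in auto)
    thus ?thesis using s False by blast
  next
    case True
    hence "w \<noteq> u" using assms(5) by simp
    moreover have "defect L {u,x} ?f w" by (rule defectI1[of x]) (use s in auto)
    ultimately show ?thesis using s by blast
  qed
  ultimately have "good {u,x} ?f" using s by (intro goodI card_le3) auto
  from good_extends[OF this] obtain \<chi> where c: "col \<chi>" "\<forall>y\<in>{u,x}. \<chi> y = ?f y" by blast
  have "\<phi> \<approx> \<chi>" by (rule single_equiv[OF assms(1)]) (use c assms in auto)
  moreover have "\<chi> \<approx> \<psi>" by (rule single_equiv[OF assms(2)]) (use c assms in auto)
  ultimately show ?thesis by (rule rtranclp_trans)
qed

lemma link_single_pair:
  assumes "single u c v" "pair x z d w" "u \<noteq> x" "u \<noteq> z" "c \<noteq> d \<or> (\<not> E u x \<and> \<not> E u z)"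
    and "(x \<noteq> v \<and> z \<noteq> v) \<or> w \<noteq> u"
    and "col \<phi>" "col \<psi>" "\<phi> u = c" "\<psi> x = d" "\<psi> z = d"
  shows "\<phi> \<approx> \<psi>"
proof -
  note s = singleD[OF assms(1)] pairD[OF assms(2)]
  have xu: "E x u \<longleftrightarrow> E u x" "E z u \<longleftrightarrow> E u z" using E_sym by blast+
  let ?f = "(\<lambda>_. d)(u := c)"
  have "list_coloring {u,x,z} L ?f"
    using s E_irrefl assms(3-5) xu by (auto simp: list_coloring_def)
  moreover have "\<exists>y\<in>V - {u,x,z}. defect L {u,x,z} ?f y"
  proof (cases "x \<noteq> v \<and> z \<noteq> v")
    case True
    have "defect L {u,x,z} ?f v" by (rule defectI1[of u]) (use s in auto)
    thus ?thesis using s True by blast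
  next
    case False
    hence "w \<noteq> u" using assms(6) by blast
    moreover have "defect L {u,x,z} ?f w"
      by (rule defectI2[of x _ z]) (use s assms(3,4) in auto)
    ultimately show ?thesis using s by blast
  qed
  ultimately have "good {u,x,z} ?f" using s by (intro goodI card_le3) auto
  from good_extends[OF this] obtain \<chi> where c: "col \<chi>" "\<forall>y\<in>{u,x,z}. \<chi> y = ?f y" by blast
  have "\<phi> \<approx> \<chi>" by (rule single_equiv[OF assms(1)]) (use c assms in auto)
  moreover have "\<chi> \<approx> \<psi>" by (rule pair_equiv[OF assms(2)]) (use c assms in auto)
  ultimately show ?thesis by (rule rtranclp_trans)
qed

subsection \<open>Lists that differ on adjacent vertices\<close>

lemma single_exists:
  assumes "single u c v" obtains \<phi> where "col \<phi>" "\<phi> u = c"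
proof -
  note s = singleD[OF assms]
  have "list_coloring {u} L (\<lambda>_. c)" using s E_irrefl by (auto simp: list_coloring_def)
  moreover have "defect L {u} (\<lambda>_. c) v" by (rule defectI1[of u]) (use s in auto)
  ultimately have "good {u} (\<lambda>_. c)" using s by (intro goodI card_le3) auto
  from good_extends[OF this] show ?thesis using that by auto
qed

lemma pair_exists:
  assumes "pair x y c v" obtains \<phi> where "col \<phi>" "\<phi> x = c" "\<phi> y = c"
  using good_extends[OF pair_good[OF assms]] that by auto

lemma equiv_via: "\<phi> \<approx> \<chi> \<Longrightarrow> \<psi> \<approx> \<chi> \<Longrightarrow> \<phi> \<approx> \<psi>"
  using rtranclp_trans swap_equiv_sym by metis

text \<open>The two colors compete for \<open>u\<close>, so a third pattern has to mediate. If none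
  does, colors are passed along edges (\<open>S1\<close>) and there are no pairs of a further color
  away from \<open>u\<close> (\<open>S2\<close>). This makes \<open>K\<close> a clique completely
  joined to \<open>v\<close>, and a vertex of \<open>K\<close> that misses \<open>u\<close> then has
  too small a degree.\<close>

lemma same_vertex_singles:
  assumes p: "single u c v" and q: "single u c' v" and ph: "col \<phi>" "\<phi> u = c" and ps: "col \<psi>" "\<psi> u = c'"
  shows "\<phi> \<approx> \<psi>"
proof (rule ccontr)
  assume ne: "\<not> \<phi> \<approx> \<psi>"
  note sp = singleD[OF p] singleD[OF q]
  have S1: "e \<in> L w" if "E x w" "x \<noteq> u" "e \<in> L x" "(e \<noteq> c \<and> e \<noteq> c') \<or> \<not> E u x" "x \<noteq> v \<or> w \<noteq> u" for x w e
  proof (rule ccontr)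
    assume "e \<notin> L w"
    hence r: "single x e w" using that by (simp add: single_def)
    obtain \<chi> where x: "col \<chi>" "\<chi> x = e" using single_exists[OF r] by blast
    have "\<phi> \<approx> \<chi>" by (rule link_single_single[OF p r]) (use that ph x in auto)
    moreover have "\<psi> \<approx> \<chi>" by (rule link_single_single[OF q r]) (use that ps x in auto)
    ultimately show False using equiv_via ne by blast
  qed
  have S2: False if r: "pair x z e w" and "u \<noteq> x" "u \<noteq> z" "e \<noteq> c" "e \<noteq> c'" "w \<noteq> u" for x z e w
  proof -
    obtain \<chi> where x: "col \<chi>" "\<chi> x = e" "\<chi> z = e" using pair_exists[OF r] by blast
    have "\<phi> \<approx> \<chi>" by (rule link_single_pair[OF p r]) (use that ph x in auto)
    moreover have "\<psi> \<approx> \<chi>" by (rule link_single_pair[OF q r]) (use that ps x in auto)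
    ultimately show False using equiv_via ne by blast
  qed
  have big: "\<exists>e\<in>L x. e \<noteq> c \<and> e \<noteq> c'" if "x \<in> V" for x
  proof (rule ccontr)
    assume "\<not> ?thesis"
    hence "L x \<subseteq> {c, c'}" by blast
    hence "card (L x) \<le> card {c, c'}" by (intro card_mono) auto
    also have "\<dots> \<le> 2" by (simp add: card_insert_if)
    finally show False using card_L[OF that] degree_ge[OF that] by simp
  qed
  define K where "K = V - {u, v}"
  have K: "clique K"
  proof (rule ccontr)
    assume "\<not> clique K"
    moreover have "connected_on K" unfolding K_def by (rule conn) (use sp card_le3 in auto)
    ultimately obtain x w z where P: "x \<in> K" "w \<in> K" "z \<in> K" "E x w" "E z w" "x \<noteq> z" "\<not> E x z"
      using induced_path by blast
    obtain e where e: "e \<in> L w" "e \<noteq> c" "e \<noteq> c'" using big[of w] P by (auto simp: K_def)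
    have "e \<in> L x" by (rule S1[of w]) (use P e E_sym in \<open>auto simp: K_def\<close>)
    moreover have "e \<in> L z" by (rule S1[of w]) (use P e E_sym in \<open>auto simp: K_def\<close>)
    ultimately have "pair x z e w" using P by (simp add: pair_def)
    thus False by (rule S2) (use P e in \<open>auto simp: K_def\<close>)
  qed
  have vK: "E v x" if x: "x \<in> K" for x
  proof (rule ccontr)
    assume nv: "\<not> E v x"
    have "\<not> nbrs V v \<subseteq> {u}"
    proof
      assume "nbrs V v \<subseteq> {u}"
      hence "card (nbrs V v) \<le> card {u}" by (intro card_mono) auto
      thus False using degree_ge[of v] sp by simp
    qed
    then obtain w where w: "w \<in> V" "E v w" "w \<noteq> u" by (auto simp: nbrs_def)
    have wK: "w \<in> K" using w E_irrefl by (auto simp: K_def)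
    have xw: "x \<noteq> w" using w nv by auto
    hence "E x w" using K wK x by (auto simp: clique_def)
    obtain e where e: "e \<in> L x" "e \<noteq> c" "e \<noteq> c'" using big[of x] x by (auto simp: K_def)
    have ew: "e \<in> L w" by (rule S1[OF \<open>E x w\<close>]) (use x e in \<open>auto simp: K_def\<close>)
    have "e \<in> L v" by (rule S1[OF E_sym[OF w(2)] _ ew]) (use w wK e sp in \<open>auto simp: K_def\<close>)
    hence "pair x v e w" using e x nv E_sym \<open>E x w\<close> w by (auto simp: pair_def K_def)
    thus False by (rule S2) (use x e sp w in \<open>auto simp: K_def\<close>)
  qed
  obtain x where x: "x \<in> K" "\<not> E u x"
  proof -
    have "\<exists>x\<in>K. \<not> E u x"
    proof (rule ccontr)
      assume "\<not> ?thesis"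
      hence "\<forall>x\<in>K. E u x" by blast
      hence "clique V" unfolding clique_def
        using K vK sp E_sym by (metis DiffI K_def clique_def empty_iff insert_iff)
      thus False using not_clique by blast
    qed
    thus ?thesis using that by blast
  qed
  have xV: "x \<in> V" "x \<noteq> u" "x \<noteq> v" using x by (auto simp: K_def)
  have Lxv: "L x \<subseteq> L v"
  proof
    fix e assume "e \<in> L x"
    thus "e \<in> L v" by (intro S1[of x v e]) (use x xV vK E_sym in auto)
  qed
  \<comment> \<open>\<open>x\<close> misses \<open>u\<close> while \<open>v\<close> sees all other
    vertices, so the list of \<open>v\<close> is larger and has a color that \<open>S1\<close> would
    pass on to \<open>x\<close>.\<close>
  have "nbrs V x \<subseteq> insert v (K - {x})"
    using x E_irrefl E_sym by (auto simp: nbrs_def K_def)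
  moreover have "insert u K \<subseteq> nbrs V v" using vK sp by (auto simp: nbrs_def K_def)
  moreover have fK: "finite K" using finite_V by (simp add: K_def)
  ultimately have "card (nbrs V x) \<le> card (insert v (K - {x}))" "card (insert u K) \<le> card (nbrs V v)"
    using finite_nbrs by (auto intro!: card_mono)
  moreover have "card (insert v (K - {x})) = card K"
    using fK card_Suc_Diff1[OF fK x(1)] by (simp add: K_def)
  moreover have "card (insert u K) = Suc (card K)" using fK by (simp add: K_def)
  ultimately have "card (L x) < card (L v)" using card_L xV sp by simp
  hence "\<not> L v \<subseteq> L x" using card_mono[of "L x" "L v"] finite_L xV(1) by auto
  then obtain e where e: "e \<in> L v" "e \<notin> L x" by blast
  have "e \<in> L x" by (rule S1[OF vK[OF x(1)]]) (use e xV sp in auto)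
  thus False using e by blast
qed


lemma clique_except_two_adjacent:
  assumes "E u u'" "clique (V - {u, u'})" "\<And>x. x \<in> V - {u, u'} \<Longrightarrow> E u x \<and> E u' x"
  shows "clique V"
  using assms E_sym unfolding clique_def by (metis DiffI empty_iff insert_iff)

lemma exists_not_in_finite:
  assumes "finite A" "card A < card B" obtains b where "b \<in> B" "b \<notin> A"
  using assms card_mono[of A B] by (meson linorder_not_le subsetI)

text \<open>\<open>u\<close> and \<open>u'\<close> cannot both get \<open>c\<close>. If no third
  pattern mediates, the rest \<open>K\<close> is a clique whose lists differ at most in
  \<open>c\<close>. As \<open>c\<close> is missing at \<open>v\<close> and \<open>v'\<close>, these
  have smallest lists, hence smallest degrees in \<open>K\<close>, and two crossed pairs in one
  coloring give the contradiction.\<close>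

lemma adjacent_singles:
  assumes p: "single u c v" and q: "single u' c v'" and uu: "E u u'"
    and ph: "col \<phi>" "\<phi> u = c" and ps: "col \<psi>" "\<psi> u' = c"
  shows "\<phi> \<approx> \<psi>"
proof (rule ccontr)
  assume ne: "\<not> \<phi> \<approx> \<psi>"
  note sp = singleD[OF p] and sq = singleD[OF q]
  have unu: "u \<noteq> u'" using uu E_irrefl by auto
  have vu': "v \<noteq> u'" "v' \<noteq> u" using sp sq by auto
  have S1: "e \<in> L w" if "E x w" "x \<noteq> u" "x \<noteq> u'" "e \<in> L x" "e \<noteq> c" "x \<noteq> v \<or> w \<noteq> u" "x \<noteq> v' \<or> w \<noteq> u'" for x w e
  proof (rule ccontr)
    assume "e \<notin> L w"
    hence r: "single x e w" using that by (simp add: single_def)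
    obtain \<chi> where x: "col \<chi>" "\<chi> x = e" using single_exists[OF r] by blast
    have "\<phi> \<approx> \<chi>" by (rule link_single_single[OF p r]) (use that ph x in auto)
    moreover have "\<psi> \<approx> \<chi>" by (rule link_single_single[OF q r]) (use that ps x in auto)
    ultimately show False using equiv_via ne by blast
  qed
  have M: "\<phi> \<approx> \<chi>" if r: "pair x z e w" and "u \<noteq> x" "u \<noteq> z" "e \<noteq> c" "w \<noteq> u" "col \<chi>" "\<chi> x = e" "\<chi> z = e" for x z e w \<chi>
    by (rule link_single_pair[OF p r]) (use that ph in auto)
  have N: "\<psi> \<approx> \<chi>" if r: "pair x z e w" and "u' \<noteq> x" "u' \<noteq> z" "e \<noteq> c" "w \<noteq> u'" "col \<chi>" "\<chi> x = e" "\<chi> z = e" for x z e w \<chi>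
    by (rule link_single_pair[OF q r]) (use that ps in auto)
  have big: "\<exists>e\<in>L x. e \<noteq> c" if "x \<in> V" for x
  proof -
    have "card {c} < card (L x)" using card_L[OF that] degree_ge[OF that] by simp
    then obtain e where "e \<in> L x" "e \<notin> {c}" using exists_not_in_finite by blast
    thus ?thesis by auto
  qed
  define K where "K = V - {u, u'}"
  have K: "clique K"
  proof (rule ccontr)
    assume "\<not> clique K"
    moreover have "connected_on K" unfolding K_def by (rule conn) (use sp sq card_le3 in auto)
    ultimately obtain x w z where P: "x \<in> K" "w \<in> K" "z \<in> K" "E x w" "E z w" "x \<noteq> z" "\<not> E x z"
      using induced_path by blast
    obtain e where e: "e \<in> L w" "e \<noteq> c" using big[of w] P by (auto simp: K_def)
    have "e \<in> L x" by (rule S1[of w]) (use P e E_sym in \<open>auto simp: K_def\<close>)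
    moreover have "e \<in> L z" by (rule S1[of w]) (use P e E_sym in \<open>auto simp: K_def\<close>)
    ultimately have r: "pair x z e w" using P by (simp add: pair_def)
    obtain \<chi> where x: "col \<chi>" "\<chi> x = e" "\<chi> z = e" using pair_exists[OF r] by blast
    have "\<phi> \<approx> \<chi>" by (rule M[OF r]) (use P e x in \<open>auto simp: K_def\<close>)
    moreover have "\<psi> \<approx> \<chi>" by (rule N[OF r]) (use P e x in \<open>auto simp: K_def\<close>)
    ultimately show False using equiv_via ne by blast
  qed
  have vK: "v \<in> K" "v' \<in> K" using sp sq vu' by (auto simp: K_def)
  have fK: "finite K" using finite_V by (simp add: K_def)
  have LK: "e \<in> L y" if "x \<in> K" "y \<in> K" "e \<in> L x" "e \<noteq> c" for x y e
  proof (cases "x = y")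
    case False
    hence "E x y" using K that by (auto simp: clique_def)
    thus ?thesis by (rule S1) (use that in \<open>auto simp: K_def\<close>)
  qed (use that in simp)
  have Lv: "L v \<subseteq> L x" "L v' \<subseteq> L x" if "x \<in> K" for x
    using LK[OF vK(1) that] LK[OF vK(2) that] sp sq by blast+
  \<comment> \<open>\<open>S1\<close> exempts the steps from \<open>v\<close> to \<open>u\<close>
    and from \<open>v'\<close> to \<open>u'\<close>; colors reach \<open>u\<close> and
    \<open>u'\<close> through another neighbor in \<open>K\<close>.\<close>
  have ends: "\<exists>x\<in>K. E a x \<and> x \<noteq> b" if "a \<in> {u,u'}" for a b
  proof -
    have "card {u,u',b} < 4" by (rule card_le3)
    hence "card {u,u',b} < card (nbrs V a)" using degree_ge[of a] that sp sq by auto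
    then obtain x where "x \<in> nbrs V a" "x \<notin> {u,u',b}" by (rule exists_not_in_finite[rotated]) auto
    thus ?thesis by (auto simp: nbrs_def K_def)
  qed
  have Lu: "L v \<subseteq> L u'" "L v' \<subseteq> L u"
  proof -
    obtain x where x: "x \<in> K" "E u' x" "x \<noteq> v'" using ends[of u' v'] by blast
    have "e \<in> L u'" if "e \<in> L v" for e
      by (rule S1[OF E_sym[OF x(2)]]) (use x that Lv(1)[OF x(1)] sp unu in \<open>auto simp: K_def\<close>)
    thus "L v \<subseteq> L u'" by blast
    obtain x where x: "x \<in> K" "E u x" "x \<noteq> v" using ends[of u v] by blast
    have "e \<in> L u" if "e \<in> L v'" for e
      by (rule S1[OF E_sym[OF x(2)]]) (use x that Lv(2)[OF x(1)] sq unu in \<open>auto simp: K_def\<close>)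
    thus "L v' \<subseteq> L u" by blast
  qed
  have deg: "card (nbrs V x) = card K - 1 + card (nbrs {u,u'} x)" if x: "x \<in> K" for x
  proof -
    have "nbrs K x = K - {x}" using K x E_irrefl by (auto simp: nbrs_def clique_def)
    hence "card (nbrs K x) = card K - 1" using x by simp
    thus ?thesis using card_nbrs_diff[of "{u,u'}" V x] sp sq by (simp add: K_def)
  qed
  have two: "nbrs {u,u'} x = {u,u'}" if "card (nbrs {u,u'} x) \<ge> 2" for x
  proof (rule card_seteq)
    show "card {u,u'} \<le> card (nbrs {u,u'} x)" using that unu by simp
  qed (auto simp: nbrs_def)
  \<comment> \<open>Degrees in \<open>K\<close> differ only by adjacency to \<open>u\<close> and
    \<open>u'\<close>. If a vertex with a smallest list sees both, all of \<open>K\<close> does, and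
    the graph is complete.\<close>
  have nv: False if ny: "nbrs {u,u'} y = {u,u'}" "y \<in> K" and Ly: "\<And>x. x \<in> K \<Longrightarrow> L y \<subseteq> L x" for y
  proof -
    have "E u x \<and> E u' x" if x: "x \<in> K" for x
    proof -
      have "card (L y) \<le> card (L x)" using Ly[OF x] finite_L x by (intro card_mono) (auto simp: K_def)
      hence "card (nbrs V y) \<le> card (nbrs V x)" using card_L x \<open>y \<in> K\<close> by (simp add: K_def)
      hence "2 \<le> card (nbrs {u,u'} x)" using deg[OF x] deg[OF \<open>y \<in> K\<close>] ny(1) unu by simp
      hence "u \<in> nbrs {u,u'} x" "u' \<in> nbrs {u,u'} x" using two by auto
      thus ?thesis using E_sym by (auto simp: nbrs_def)
    qed
    hence "clique V" using clique_except_two_adjacent[OF uu] K unfolding K_def by blast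
    thus False using not_clique by blast
  qed
  have nvu': "\<not> E v u'"
  proof
    assume "E v u'"
    hence "nbrs {u,u'} v = {u,u'}" using sp by (auto simp: nbrs_def)
    thus False using nv[of v] vK Lv(1) by blast
  qed
  have nv'u: "\<not> E v' u"
  proof
    assume "E v' u"
    hence "nbrs {u,u'} v' = {u,u'}" using sq by (auto simp: nbrs_def)
    thus False using nv[of v'] vK Lv(2) by blast
  qed
  have vv': "v \<noteq> v'" using nv'u sp by auto
  have cardv: "card (L v) \<ge> 4" using card_L[of v] degree_ge[of v] sp by simp
  obtain b where b: "b \<in> L v" using cardv by fastforce
  have "card {b} < card (L v)" using cardv by simp
  then obtain b' where b': "b' \<in> L v" "b' \<notin> {b}" by (rule exists_not_in_finite[rotated]) auto
  have bc: "b \<noteq> c" "b' \<noteq> c" using b b' sp by auto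
  have bL: "b \<in> L u'" "b' \<in> L v'" "b' \<in> L u"
  proof -
    show "b \<in> L u'" using b Lu by auto
    show "b' \<in> L v'" using b' Lv(1)[OF vK(2)] by auto
    thus "b' \<in> L u" using Lu by auto
  qed
  \<comment> \<open>Four vertices may separate the graph, so a defect is found at every remaining
    vertex: it sees \<open>v\<close>, \<open>v'\<close> and, by its degree, one of \<open>u\<close>
    and \<open>u'\<close>, hence both ends of the pair \<open>u v'\<close> or of the pair
    \<open>u' v\<close>. These two pairs are then linked to \<open>\<psi>\<close> and to
    \<open>\<phi>\<close>, respectively.\<close>
  let ?X = "{u,u',v,v'}" and ?f = "(\<lambda>_. b')(u' := b, v := b)"
  have f: "?f u = b'" "?f u' = b" "?f v = b" "?f v' = b'" using unu sp sq vu' vv' by auto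
  have "list_coloring ?X L ?f"
  proof (rule list_coloringI)
    fix x assume "x \<in> ?X"
    thus "?f x \<in> L x" using f b b' bL by auto
    fix y assume "y \<in> ?X" "E x y"
    thus "?f x \<noteq> ?f y" using \<open>x \<in> ?X\<close> f b' nvu' nv'u E_irrefl E_sym by (elim insertE) auto
  qed
  moreover have "\<exists>x\<in>A. defect L ?X ?f x" if A: "closed_in (V - ?X) A" "A \<noteq> {}" for A
  proof -
    obtain w where w: "w \<in> A" using A by blast
    have wK: "w \<in> K" "w \<noteq> v" "w \<noteq> v'" using w A by (auto simp: closed_in_def K_def)
    have wv: "E w v" "E w v'" using K wK vK by (auto simp: clique_def)
    have "E w u \<or> E w u'"
    proof (rule ccontr)
      assume "\<not> ?thesis"
      hence "nbrs {u,u'} w = {}" by (auto simp: nbrs_def)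
      hence 1: "card (nbrs V w) = card K - 1" using deg[OF wK(1)] by simp
      have "u \<in> nbrs {u,u'} v" using sp by (auto simp: nbrs_def)
      hence "0 < card (nbrs {u,u'} v)" using finite_nbrs card_gt_0_iff by blast
      hence 2: "card (nbrs V w) < card (nbrs V v)" using deg[OF vK(1)] 1 by simp
      have "card (L v) \<le> card (L w)" using Lv(1)[OF wK(1)] finite_L wK by (intro card_mono) (auto simp: K_def)
      thus False using 2 card_L[of v] card_L[of w] sp wK by (simp add: K_def)
    qed
    thus ?thesis
    proof
      assume "E w u"
      have "defect L ?X ?f w" by (rule defectI2[of u _ v']) (use \<open>E w u\<close> wv f vu' in auto)
      thus ?thesis using w by blast
    next
      assume "E w u'"
      have "defect L ?X ?f w" by (rule defectI2[of u' _ v]) (use \<open>E w u'\<close> wv f vu' in auto)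
      thus ?thesis using w by blast
    qed
  qed
  moreover have "?X \<subseteq> V" using sp sq by auto
  ultimately obtain \<chi> where ch: "col \<chi>" "\<forall>x\<in>?X. \<chi> x = ?f x"
    using precoloring_extends[OF finite_V degree_lists_L] by blast
  have chv: "\<chi> u = b'" "\<chi> v' = b'" "\<chi> u' = b" "\<chi> v = b" using ch(2) f by auto
  obtain w where w: "w \<in> K" "E u' w" using ends[of u' u'] by blast
  have wv: "w \<noteq> v" using w nvu' E_sym by auto
  have "E v w" using K w wv vK by (auto simp: clique_def)
  hence r: "pair u' v b w" using w b bL nvu' vu' E_sym by (auto simp: pair_def)
  have "\<phi> \<approx> \<chi>" by (rule M[OF r]) (use unu sp w bc ch chv in \<open>auto simp: K_def\<close>)
  obtain w' where w': "w' \<in> K" "E u w'" using ends[of u u] by blast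
  have wv: "w' \<noteq> v'" using w' nv'u E_sym by auto
  have "E v' w'" using K w' wv vK by (auto simp: clique_def)
  hence r: "pair u v' b' w'" using w' b' bL nv'u vu' E_sym by (auto simp: pair_def)
  have "\<psi> \<approx> \<chi>" by (rule N[OF r]) (use unu sq w' bc ch chv in \<open>auto simp: K_def\<close>)
  thus False using \<open>\<phi> \<approx> \<chi>\<close> equiv_via ne by blast
qed

lemma same_color_singles:
  assumes p: "single u c v" and q: "single u' c v'"
    and ph: "col \<phi>" "\<phi> u = c" and ps: "col \<psi>" "\<psi> u' = c"
  shows "\<phi> \<approx> \<psi>"
proof (cases "u = u'")
  case True
  thus ?thesis using single_equiv[OF p ph(1) ps(1)] ph ps by simp
next
  case False
  have "u' \<noteq> v" using singleD[OF p] singleD[OF q] by auto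
  show ?thesis
  proof (cases "E u u'")
    case True
    thus ?thesis using adjacent_singles[OF p q True ph ps] by blast
  next
    case nE: False
    show ?thesis by (rule link_single_single[OF p q]) (use False nE \<open>u' \<noteq> v\<close> ph ps in auto)
  qed
qed

section \<open>Components to which a precoloring does not extend\<close>

definition stuck :: "'a set \<Rightarrow> ('a \<Rightarrow> 'c) \<Rightarrow> 'a set \<Rightarrow> bool" where
  "stuck X f A \<longleftrightarrow> A \<noteq> {} \<and> closed_in (V - X) A \<and> connected_on A \<and>
     \<not> (\<exists>g. list_coloring A (reduced L X f) g)"

text \<open>A smallest uncolorable closed set is connected, since colorings of two complementary
  closed parts combine.\<close>

lemma stuck_exists:
  assumes f: "list_coloring X L f" and no: "\<not> (\<exists>\<phi>. col \<phi> \<and> (\<forall>x\<in>X. \<phi> x = f x))"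
  obtains A where "stuck X f A"
proof -
  let ?R = "reduced L X f"
  let ?P = "\<lambda>A. closed_in (V - X) A \<and> \<not> (\<exists>g. list_coloring A ?R g)"
  have "?P (V - X)"
  proof (intro conjI notI)
    show "closed_in (V - X) (V - X)" by (simp add: closed_in_def)
    assume "\<exists>g. list_coloring (V - X) ?R g"
    then obtain g where "list_coloring (V - X) ?R g" by blast
    from glue_coloring[OF f this] show False using no by force
  qed
  then obtain A where A: "?P A" and min: "\<And>B. ?P B \<Longrightarrow> card A \<le> card B"
    using ex_has_least_nat[of ?P "V - X" card] by blast
  have AV: "A \<subseteq> V - X" using A by (auto simp: closed_in_def)
  have fin: "finite A" using AV finite_V finite_subset by blast
  have "A \<noteq> {}" using A by (auto simp: list_coloring_def)
  moreover have "connected_on A"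
    unfolding connected_on_def
  proof (intro allI impI)
    fix B assume B: "closed_in A B"
    show "B = {} \<or> B = A"
    proof (rule ccontr)
      assume ne: "\<not> ?thesis"
      have sub: "B \<subseteq> A" using B by (auto simp: closed_in_def)
      have c1: "closed_in (V - X) B"
        using A B AV unfolding closed_in_def by blast
      have c2: "closed_in (V - X) (A - B)"
        using A B AV E_sym unfolding closed_in_def by blast
      have "card B < card A" using ne sub fin by (intro psubset_card_mono) auto
      then obtain g1 where g1: "list_coloring B ?R g1" using min[of B] c1 by force
      have "card (A - B) < card A" using ne sub fin by (intro psubset_card_mono) auto
      then obtain g2 where g2: "list_coloring (A - B) ?R g2" using min[of "A - B"] c2 by force
      have cross: "\<not> E x y" "\<not> E y x" if "x \<in> B" "y \<in> A - B" for x y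
        using B that E_sym unfolding closed_in_def by blast+
      have "list_coloring A ?R (\<lambda>v. if v \<in> B then g1 v else g2 v)"
      proof (rule list_coloringI)
        fix v assume v: "v \<in> A"
        show "(if v \<in> B then g1 v else g2 v) \<in> ?R v"
          using v list_coloringD(1)[OF g1, of v] list_coloringD(1)[OF g2, of v] by auto
        fix w assume w: "w \<in> A" "E v w"
        show "(if v \<in> B then g1 v else g2 v) \<noteq> (if w \<in> B then g1 w else g2 w)"
          using v w cross[of v w] cross[of w v] list_coloringD(2)[OF g1, of v w] list_coloringD(2)[OF g2, of v w]
          by (cases "v \<in> B"; cases "w \<in> B") auto
      qed
      thus False using A by blast
    qed
  qed
  ultimately show ?thesis using A that unfolding stuck_def by blast
qed

lemma stuck_nbrs: "stuck X f A \<Longrightarrow> d \<in> A \<Longrightarrow> nbrs A d = nbrs (V - X) d"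
  unfolding stuck_def closed_in_def nbrs_def by blast

lemma stuck_subset: "stuck X f A \<Longrightarrow> A \<subseteq> V - X" "stuck X f A \<Longrightarrow> finite A"
  unfolding stuck_def closed_in_def using finite_V by (auto intro: finite_subset)

lemma stuck_degree_lists:
  assumes "stuck X f A" "X \<subseteq> V"
  shows "degree_lists A (reduced L X f)"
  unfolding degree_lists_def
proof
  fix d assume d: "d \<in> A"
  hence dV: "d \<in> V" using stuck_subset(1)[OF assms(1)] by blast
  show "finite (reduced L X f d) \<and> card (nbrs A d) \<le> card (reduced L X f d)"
    using card_reduced_ge(1)[of L d V X f] finite_L[OF dV] card_L[OF dV] assms(2) stuck_nbrs[OF assms(1) d]
    by (simp add: reduced_def)
qed

text \<open>A single strict inequality in the connected set \<open>A\<close> would be a surplus and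
  make \<open>A\<close> colorable.\<close>

lemma stuck_card:
  assumes "stuck X f A" "X \<subseteq> V" "d \<in> A"
  shows "card (reduced L X f d) = card (nbrs A d)"
proof (rule ccontr)
  assume ne: "\<not> ?thesis"
  have "degree_lists A (reduced L X f)" by (rule stuck_degree_lists[OF assms(1,2)])
  moreover from this have "card (nbrs A d) < card (reduced L X f d)"
    using ne assms(3) unfolding degree_lists_def by fastforce
  moreover have "connected_on A" using assms(1) by (simp add: stuck_def)
  ultimately have "surplus_lists A (reduced L X f)"
    using assms(3) unfolding surplus_lists_def connected_on_def by metis
  thus False using surplus_colorable[OF stuck_subset(2)[OF assms(1)]] assms(1) by (auto simp: stuck_def)
qed

lemma stuck_no_defect:
  assumes "stuck X f A" "X \<subseteq> V" "d \<in> A" shows "\<not> defect L X f d"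
proof
  assume def: "defect L X f d"
  have dV: "d \<in> V" using stuck_subset(1)[OF assms(1)] assms(3) by blast
  have "card (nbrs (V - X) d) < card (reduced L X f d)"
    by (rule card_reduced_ge(2)[OF _ _ assms(2) def]) (use finite_L[OF dV] card_L[OF dV] in auto)
  thus False using stuck_card[OF assms] stuck_nbrs[OF assms(1,3)] by simp
qed

text \<open>A color available at \<open>e\<close> but not at \<open>d\<close> could be given to
  \<open>e\<close>: then \<open>d\<close> loses a neighbor but no color, and the remaining clique
  has a surplus.\<close>

lemma stuck_clique_lists_subset:
  assumes s: "stuck X f A" and X: "X \<subseteq> V" and A: "clique A" and d: "d \<in> A" and e: "e \<in> A"
  shows "reduced L X f e \<subseteq> reduced L X f d"
proof (rule ccontr)
  let ?R = "reduced L X f"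
  assume "\<not> ?thesis"
  then obtain \<gamma> where g: "\<gamma> \<in> ?R e" "\<gamma> \<notin> ?R d" by blast
  have de: "d \<noteq> e" "E d e" using g A d e by (auto simp: clique_def)
  have "\<exists>\<phi>. list_coloring A ?R \<phi> \<and> (\<forall>x\<in>{e}. \<phi> x = (\<lambda>_. \<gamma>) x)"
  proof (rule precoloring_extends[OF stuck_subset(2)[OF s] stuck_degree_lists[OF s X]])
    show "{e} \<subseteq> A" using e by simp
    show "list_coloring {e} ?R (\<lambda>_. \<gamma>)" using g E_irrefl by (auto simp: list_coloring_def)
    fix B assume B: "closed_in (A - {e}) B" "B \<noteq> {}"
    then obtain b where b: "b \<in> B" by blast
    have "d \<in> B"
    proof (rule ccontr)
      assume "d \<notin> B"
      moreover have "E b d" using calculation b B A d by (auto simp: clique_def closed_in_def)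
      ultimately show False using B b d de unfolding closed_in_def by blast
    qed
    moreover have "defect ?R {e} (\<lambda>_. \<gamma>) d" by (rule defectI1[of e]) (use de g in auto)
    ultimately show "\<exists>v\<in>B. defect ?R {e} (\<lambda>_. \<gamma>) v" by blast
  qed
  thus False using s unfolding stuck_def by blast
qed

lemma stuck_clique_lists:
  assumes "stuck X f A" "X \<subseteq> V" "clique A" "d \<in> A" "e \<in> A"
  shows "reduced L X f e = reduced L X f d"
  using stuck_clique_lists_subset assms by blast

text \<open>Otherwise \<open>X - {s}\<close>, with fewer than four vertices, would already cut off
  \<open>A\<close>.\<close>

lemma separator_adjacent:
  assumes "X \<subseteq> V" "card X \<le> 4" "closed_in (V - X) A" "A \<noteq> {}" "s \<in> X"
  obtains a where "a \<in> A" "E a s"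
proof -
  have finX: "finite X" using assms(1) finite_V finite_subset by blast
  have "card (X - {s}) < 4" using card_Diff1_less[OF finX assms(5)] assms(2) by simp
  hence c: "connected_on (V - (X - {s}))" by (intro conn) (use assms(1) in auto)
  have A: "A \<subseteq> V - X" using assms(3) by (simp add: closed_in_def)
  obtain a b where "a \<in> A" "b \<in> V - (X - {s})" "b \<notin> A" "E a b"
    by (rule connected_onD[OF c, of A]) (use A assms in auto)
  moreover have "b = s" using calculation assms(3) unfolding closed_in_def by blast
  ultimately show ?thesis using that by blast
qed

text \<open>The descent step that makes a smallest uncolorable part a clique: \<open>V - A - {x, y}\<close> is
  connected, or consists of \<open>s\<close> and \<open>t\<close> only, so \<open>B\<close> misses it up to one vertex.\<close>

lemma smaller_closed_part:
  assumes V: "{x, y, s, t} \<subseteq> V" and dist: "s \<noteq> t" "s \<notin> {x, y}" "t \<notin> {x, y}"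
    and A: "closed_in (V - {x, y, s, t}) A" and eh: "e \<in> A" "h \<in> A" "e \<noteq> h"
    and B: "closed_in (V - {x, y, e, h}) B" and v: "v \<in> V" "v \<notin> A" "v \<notin> {x, y}" "v \<notin> B"
  shows "card B < card A"
proof -
  \<comment> \<open>Outside \<open>A\<close> and \<open>{x, y}\<close> the set \<open>B\<close>
    splits the graph into \<open>R2\<close> and \<open>R1\<close> without edges in between, and only
    \<open>s\<close> and \<open>t\<close> can have neighbors in \<open>A\<close>. The vertex
    \<open>v\<close> keeps \<open>R1\<close> nonempty. If \<open>s\<close> and \<open>t\<close> lie
    on the same side, \<open>{x, y}\<close> cuts off the other side.\<close>
  define R1 R2 where "R1 = V - A - {x, y} - B" and "R2 = B - A"
  have AV: "A \<subseteq> V - {x,y,s,t}" and BV: "B \<subseteq> V - {x,y,e,h}" using A B by (auto simp: closed_in_def)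
  have finA: "finite A" and finB: "finite B" using AV BV finite_V finite_subset by blast+
  have st: "s \<notin> A" "t \<notin> A" using AV by auto
  have R12: "\<not> E a b" "\<not> E b a" if "a \<in> R1" "b \<in> R2" for a b
  proof -
    have "b \<in> B" "a \<in> V - {x,y,e,h} - B" using that eh by (auto simp: R1_def R2_def)
    thus "\<not> E b a" using B unfolding closed_in_def by blast
    thus "\<not> E a b" using E_sym by blast
  qed
  have RA: "\<not> E r a" if "r \<in> R1 \<union> R2" "r \<noteq> s" "r \<noteq> t" "a \<in> A" for r a
  proof -
    have "r \<in> V" "r \<notin> {x,y}" "r \<notin> A" using that(1) BV by (auto simp: R1_def R2_def)
    hence "r \<in> V - {x,y,s,t} - A" using that(2,3) by simp
    hence "\<not> E a r" using A that(4) unfolding closed_in_def by blast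
    thus ?thesis using E_sym by blast
  qed
  have split: "V = {x,y} \<union> A \<union> R1 \<union> R2"
  proof
    show "V \<subseteq> {x,y} \<union> A \<union> R1 \<union> R2" unfolding R1_def R2_def by blast
    show "{x,y} \<union> A \<union> R1 \<union> R2 \<subseteq> V" using V AV BV unfolding R1_def R2_def by blast
  qed
  have stR: "s \<in> R1 \<union> R2" "t \<in> R1 \<union> R2" using V dist st by (auto simp: R1_def R2_def)
  have vR: "v \<in> R1" using v by (auto simp: R1_def)
  have disj: "R1 \<inter> R2 = {}" "A \<inter> R1 = {}" "A \<inter> R2 = {}" "{x,y} \<inter> R1 = {}" "{x,y} \<inter> R2 = {}"
    using BV by (auto simp: R1_def R2_def)
  show ?thesis
  proof (cases "R2 = {}")
    case True
    hence "B \<subseteq> A - {e,h}" using BV by (auto simp: R2_def)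
    hence "B \<subset> A" using eh by blast
    thus ?thesis by (rule psubset_card_mono[OF finA])
  next
    case False
    have cut: "D = {} \<or> D = V - Y" if "Y \<subseteq> V" "card Y < 4" "closed_in (V - Y) D" for Y D
      using conn[OF that(1,2)] that(3) unfolding connected_on_def by blast
    have c2: "card {x,y} < 4" "card {x,y,s} < 4" "card {x,y,t} < 4" by (rule card_le3)+
    have A0: "A \<noteq> {}" using eh by blast
    have h1: "\<not> E a b" if "a \<in> R1" "a \<noteq> s" "a \<noteq> t" "b \<in> A \<union> R2" for a b
      using that RA[of a b] R12(1)[of a b] by blast
    have h2: "\<not> E a b" if "a \<in> R2" "a \<noteq> s" "a \<noteq> t" "b \<in> A \<union> R1" for a b
      using that RA[of a b] R12(2)[of b a] by blast
    have n1: "\<not> (s \<in> R1 \<and> t \<in> R1)"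
    proof
      assume r: "s \<in> R1 \<and> t \<in> R1"
      have "closed_in (V - {x,y}) R2"
        unfolding closed_in_def
      proof (intro conjI ballI)
        show "R2 \<subseteq> V - {x,y}" using split disj by blast
        fix a b assume ab: "a \<in> R2" "b \<in> V - {x,y} - R2"
        have "a \<noteq> s" "a \<noteq> t" using ab r disj by blast+
        moreover have "b \<in> A \<union> R1" using ab(2) split by blast
        ultimately show "\<not> E a b" using ab(1) h2 by blast
      qed
      moreover have "{x,y} \<subseteq> V" using V by blast
      ultimately have "R2 = V - {x,y}" using cut[OF _ c2(1)] False by blast
      hence "R1 = {}" using split disj(1,4) by blast
      thus False using vR by blast
    qed
    have n2: "\<not> (s \<in> R2 \<and> t \<in> R2)"
    proof
      assume r: "s \<in> R2 \<and> t \<in> R2"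
      have "closed_in (V - {x,y}) R1"
        unfolding closed_in_def
      proof (intro conjI ballI)
        show "R1 \<subseteq> V - {x,y}" using split disj by blast
        fix a b assume ab: "a \<in> R1" "b \<in> V - {x,y} - R1"
        have "a \<noteq> s" "a \<noteq> t" using ab r disj by blast+
        moreover have "b \<in> A \<union> R2" using ab(2) split by blast
        ultimately show "\<not> E a b" using ab(1) h1 by blast
      qed
      moreover have "{x,y} \<subseteq> V" using V by blast
      ultimately have "R1 = V - {x,y}" using cut[OF _ c2(1)] vR by blast
      hence "R2 = {}" using split disj(1,5) by blast
      thus False using False by blast
    qed
    \<comment> \<open>With \<open>s\<close> and \<open>t\<close> on different sides, any vertex of
      \<open>R2\<close> besides \<open>q\<close> would be cut off by \<open>{x, y, q}\<close>. So
      \<open>B\<close> gains at most \<open>q\<close> and loses \<open>e\<close> and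
      \<open>h\<close>.\<close>
    have sgl: "R2 \<subseteq> {q}" if q: "q \<in> {s,t}" "q \<in> R2" and m: "m \<in> {s,t}" "m \<in> R1" for q m
    proof (rule ccontr)
      assume ne: "\<not> ?thesis"
      have qV: "{x,y,q} \<subseteq> V" using V q by auto
      have st2: "{s,t} = {q,m}" using q m disj dist by blast
      have "closed_in (V - {x,y,q}) (R2 - {q})"
        unfolding closed_in_def
      proof (intro conjI ballI)
        show "R2 - {q} \<subseteq> V - {x,y,q}" using split disj by blast
        fix a b assume ab: "a \<in> R2 - {q}" "b \<in> V - {x,y,q} - (R2 - {q})"
        have "a \<noteq> s" "a \<noteq> t" using ab q m disj st2 by blast+
        moreover have "b \<in> A \<union> R1" using ab(2) split by blast
        ultimately show "\<not> E a b" using ab(1) h2 by blast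
      qed
      hence "R2 - {q} = V - {x,y,q}" using cut[OF qV card_le3(3)] ne by blast
      moreover have "R1 \<subseteq> V - {x,y,q}" using split disj(1,4) q by blast
      ultimately show False using vR disj(1) by blast
    qed
    obtain q where q: "q \<in> {s,t}" "R2 \<subseteq> {q}"
      using n1 n2 stR sgl[of s t] sgl[of t s] by blast
    hence "B \<subseteq> insert q (A - {e,h})" using BV by (auto simp: R2_def)
    hence "card B \<le> card (insert q (A - {e,h}))" using finA by (intro card_mono) auto
    also have "\<dots> = Suc (card (A - {e,h}))" using q st finA by auto
    also have "\<dots> < card A"
    proof -
      have "A - {e,h} = A - {e} - {h}" by blast
      hence "Suc (Suc (card (A - {e,h}))) = card A"
        using card_Suc_Diff1[of "A - {e}" h] card_Suc_Diff1[OF finA eh(1)] eh finA by simp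
      thus ?thesis by simp
    qed
    finally show ?thesis .
  qed
qed

text \<open>\<open>u\<close> cannot have both \<open>c\<close> and \<open>c'\<close>, and four
  vertices are needed to mediate. Pairs of a third color \<open>b\<close> away from \<open>u\<close>
  and \<open>y\<close> lie in the class of \<open>\<phi>0\<close>, so none extends together with the
  pair \<open>u y\<close>. A smallest obstruction is a clique, and counting the colors that a member
  of the class of \<open>\<phi>\<close> uses on it gives the contradiction.\<close>

lemma single_vs_pair:
  assumes p: "single u c v" and q: "pair u y c' v" and c'v: "c' \<in> L v"
    and p0: "col \<phi>0" "\<phi>0 u = c" and ph: "col \<phi>" "\<phi> u = c'" "\<phi> y = c'"
  shows "\<phi>0 \<approx> \<phi>"
proof (rule ccontr)
  assume ne: "\<not> \<phi>0 \<approx> \<phi>"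
  note sp = singleD[OF p] and sq = pairD[OF q]
  have cc: "c \<noteq> c'" using sp c'v by auto
  have "y \<in> V" using sq by simp
  \<comment> \<open>The pattern of \<open>\<phi>\<close> around \<open>y\<close> must clash with the
    single at \<open>u\<close>, and it can do so only by color \<open>c\<close> on a neighbor of
    \<open>u\<close>. As \<open>u'\<close> turns out not to see \<open>v\<close>, \<open>W\<close>
    is not a clique.\<close>
  obtain u' where u': "u' \<in> V" "E u' y" "E u u'" "\<phi> u' = c"
    using ph(1) \<open>y \<in> V\<close>
  proof (cases rule: exists_pattern)
    case (single x)
    note sx = singleD[OF single]
    have ux: "u \<noteq> x" using sx sq by blast
    have "\<phi> x = c \<and> E u x"
    proof (rule ccontr)
      assume "\<not> ?thesis"
      hence "\<phi>0 \<approx> \<phi>"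
        by (intro link_single_single[OF p single ux]) (use p0 ph sq in auto)
      thus False using ne by blast
    qed
    thus ?thesis using that[of x] sx by blast
  next
    case (pair x z)
    note sx = pairD[OF pair(1)]
    have ux: "u \<noteq> x" "u \<noteq> z" using sx sq by blast+
    have "\<phi> x = c \<and> (E u x \<or> E u z)"
    proof (rule ccontr)
      assume "\<not> ?thesis"
      hence "\<phi>0 \<approx> \<phi>"
        by (intro link_single_pair[OF p pair(1) ux]) (use p0 ph sq pair in auto)
      thus False using ne by blast
    qed
    thus ?thesis using that[of x] that[of z] sx pair(2) by auto
  qed
  have cu': "c \<in> L u'" using list_coloringD(1)[OF ph(1) u'(1)] u'(4) by simp
  have u'v: "u' \<noteq> v" "u' \<noteq> u" "u' \<noteq> y" using cu' sp u' E_irrefl by auto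
  have nu'v: "\<not> E u' v"
  proof
    assume "E u' v"
    hence "single u' c v" using cu' sp by (simp add: single_def)
    from same_color_singles[OF p this p0 ph(1) u'(4)] show False using ne by blast
  qed
  define W where "W = V - {u, y}"
  have WV: "W \<subseteq> V" by (auto simp: W_def)
  have cW: "connected_on W" unfolding W_def by (rule conn) (use sp sq card_le3 in auto)
  have vW: "v \<in> W" using sp sq by (auto simp: W_def)
  have nW: "\<not> clique W" using vW u' u'v nu'v by (auto simp: W_def clique_def)
  have "card {c, c'} < 4" by (rule card_le3)
  hence "card {c, c'} < card (L v)" using card_L[of v] degree_ge[of v] sp by simp
  then obtain b where b: "b \<in> L v" "b \<notin> {c, c'}" by (rule exists_not_in_finite[rotated]) auto
  \<comment> \<open>Otherwise \<open>b\<close> is lost along an edge of the connected set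
    \<open>W\<close>; this single is compatible with both patterns.\<close>
  have bL: "b \<in> L t" if "t \<in> W" for t
  proof (rule ccontr)
    assume nt: "b \<notin> L t"
    let ?T = "{t \<in> W. b \<in> L t}"
    have T: "?T \<subseteq> W" "?T \<noteq> {}" "?T \<noteq> W" using vW b nt that by auto
    obtain a d where ad: "a \<in> ?T" "d \<in> W" "d \<notin> ?T" "E a d" by (rule connected_onD[OF cW T])
    have r: "single a b d" using ad by (simp add: single_def)
    obtain \<chi> where x: "col \<chi>" "\<chi> a = b" using single_exists[OF r] by blast
    have "\<phi>0 \<approx> \<chi>" by (rule link_single_single[OF p r]) (use ad b p0 x in \<open>auto simp: W_def\<close>)
    moreover have "\<chi> \<approx> \<phi>" by (rule link_single_pair[OF r q]) (use ad b ph x in \<open>auto simp: W_def\<close>)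
    ultimately show False using ne rtranclp_trans by metis
  qed
  define P where "P x z \<longleftrightarrow> x \<in> W \<and> z \<in> W \<and> (\<exists>w\<in>W. pair x z b w)" for x z
  define F where "F x z = (\<lambda>_. c')(x := b, z := b)" for x z :: 'a
  have PM: "\<phi>0 \<approx> \<chi>" if Pxz: "P x z" and "col \<chi>" "\<chi> x = b" "\<chi> z = b" for x z \<chi>
  proof -
    obtain w where w: "w \<in> W" "pair x z b w" "x \<in> W" "z \<in> W" using Pxz by (auto simp: P_def)
    show ?thesis by (rule link_single_pair[OF p w(2)]) (use w b p0 that in \<open>auto simp: W_def\<close>)
  qed
  have Fv: "F x z u = c'" "F x z y = c'" "F x z x = b" "F x z z = b" if "P x z" for x z
    using that by (auto simp: P_def F_def W_def)
  have ex: "\<exists>A. stuck {u,y,x,z} (F x z) A" if Pxz: "P x z" for x z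
  proof -
    have xz: "x \<in> W" "z \<in> W" "\<not> E x z" "\<not> E z x" "x \<noteq> z" using Pxz pairD by (auto simp: P_def)
    have l: "list_coloring {u,y,x,z} L (F x z)"
    proof (rule list_coloringI)
      fix a assume a: "a \<in> {u,y,x,z}"
      thus "F x z a \<in> L a" using Fv[OF Pxz] bL xz sq by auto
      fix d assume d: "d \<in> {u,y,x,z}" "E a d"
      thus "F x z a \<noteq> F x z d" using a Fv[OF Pxz] b sq xz E_irrefl by (elim insertE) auto
    qed
    have "\<not> (\<exists>\<chi>. col \<chi> \<and> (\<forall>a\<in>{u,y,x,z}. \<chi> a = F x z a))"
    proof
      assume "\<exists>\<chi>. col \<chi> \<and> (\<forall>a\<in>{u,y,x,z}. \<chi> a = F x z a)"
      then obtain \<chi> where x: "col \<chi>" "\<chi> u = c'" "\<chi> y = c'" "\<chi> x = b" "\<chi> z = b" using Fv[OF Pxz] by auto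
      have "\<phi>0 \<approx> \<chi>" by (rule PM[OF Pxz x(1,4,5)])
      moreover have "\<chi> \<approx> \<phi>" by (rule pair_equiv[OF q x(1) ph(1) x(2,3) ph(2,3)])
      ultimately show False using ne rtranclp_trans by metis
    qed
    from stuck_exists[OF l this] show ?thesis by blast
  qed
  \<comment> \<open>The pair changes in the descent, so the minimum is taken over pairs together
    with their obstructions.\<close>
  let ?Q = "\<lambda>(x, z, A). P x z \<and> stuck {u,y,x,z} (F x z) A"
  have "\<exists>T. ?Q T"
  proof -
    obtain x w z where P3: "x \<in> W" "w \<in> W" "z \<in> W" "E x w" "E z w" "x \<noteq> z" "\<not> E x z"
      by (rule induced_path[OF cW nW])
    hence "P x z" using bL by (auto simp: P_def pair_def)
    thus ?thesis using ex by blast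
  qed
  then obtain T where T: "?Q T" and min: "\<And>T'. ?Q T' \<Longrightarrow> card (snd (snd T)) \<le> card (snd (snd T'))"
    using ex_has_least_nat[of ?Q _ "\<lambda>T. card (snd (snd T))"] by blast
  obtain x z A where Teq: "T = (x, z, A)" by (cases T)
  have Pxz: "P x z" and st: "stuck {u,y,x,z} (F x z) A" using T Teq by auto
  have min': "card A \<le> card A'" if "P x' z'" "stuck {u,y,x',z'} (F x' z') A'" for x' z' A'
    using min[of "(x', z', A')"] that Teq by simp
  have xz: "x \<in> W" "z \<in> W" "\<not> E x z" "\<not> E z x" "x \<noteq> z" using Pxz pairD by (auto simp: P_def)
  have XV: "{u,y,x,z} \<subseteq> V" using xz sp sq by (auto simp: W_def)
  have AV: "A \<subseteq> V - {u,y,x,z}" by (rule stuck_subset(1)[OF st])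
  have AW: "A \<subseteq> W" using AV by (auto simp: W_def)
  have finA: "finite A" by (rule stuck_subset(2)[OF st])
  have clA: "closed_in (V - {u,y,x,z}) A" and A0: "A \<noteq> {}" and cA: "connected_on A"
    using st by (auto simp: stuck_def)
  have defv: "defect L {u,y,x',z'} (F x' z') v" if "P x' z'" for x' z'
    by (rule defectI2[of u _ y]) (use sp sq Fv[OF that] in auto)
  have vA: "v \<notin> A" using stuck_no_defect[OF st XV] defv[OF Pxz] by blast
  have clq: "clique A"
  proof (rule ccontr)
    assume "\<not> clique A"
    then obtain e g h where P3: "e \<in> A" "g \<in> A" "h \<in> A" "E e g" "E h g" "e \<noteq> h" "\<not> E e h"
      by (rule induced_path[OF cA])
    have inW: "e \<in> W" "g \<in> W" "h \<in> W" using P3 AW by auto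
    have Peh: "P e h" using P3 inW bL by (auto simp: P_def pair_def)
    then obtain B where B: "stuck {u,y,e,h} (F e h) B" using ex by blast
    have XV': "{u,y,e,h} \<subseteq> V" using inW sp sq by (auto simp: W_def)
    have vB: "v \<notin> B" using stuck_no_defect[OF B XV'] defv[OF Peh] by blast
    have "card B < card A"
    proof (rule smaller_closed_part[OF XV _ _ _ clA P3(1,3,6)])
      show "closed_in (V - {u,y,e,h}) B" using B by (simp add: stuck_def)
      show "v \<in> V" "v \<notin> A" "v \<notin> {u,y}" "v \<notin> B" using vW vA vB by (auto simp: W_def)
    qed (use xz in \<open>auto simp: W_def\<close>)
    thus False using min'[OF Peh B] by simp
  qed
  \<comment> \<open>The end has to differ from \<open>v\<close>, whose defect is used to extend the
    coloring.\<close>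
  obtain x0 where x0: "x0 \<in> {x,z}" "x0 \<noteq> v" using xz(5) by blast
  have x0W: "x0 \<in> W" using x0 xz by auto
  obtain \<phi>' where ph': "col \<phi>'" "\<phi>' u = c'" "\<phi>' y = c'" "\<phi>' x0 = b"
    by (rule pair_extends[OF q, of x0 b]) (use x0 x0W bL[OF x0W] b in \<open>auto simp: W_def\<close>)
  have ne': "\<not> \<phi>0 \<approx> \<phi>'"
  proof
    assume "\<phi>0 \<approx> \<phi>'"
    moreover have "\<phi>' \<approx> \<phi>" by (rule pair_equiv[OF q ph'(1) ph(1) ph'(2,3) ph(2,3)])
    ultimately show False using ne rtranclp_trans by metis
  qed
  \<comment> \<open>A vertex of the clique with color \<open>b\<close> would form a pair with
    \<open>x0\<close>, their common neighbor being a vertex of \<open>A\<close> next to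
    \<open>x0\<close>; that puts \<open>\<phi>'\<close> into the class of
    \<open>\<phi>0\<close>.\<close>
  have nb: "\<phi>' d \<noteq> b" if d: "d \<in> A" for d
  proof
    assume db: "\<phi>' d = b"
    have dW: "d \<in> W" "d \<in> V" using d AW WV by auto
    have nE: "\<not> E x0 d" using list_coloringD(2)[OF ph'(1), of x0 d] x0W WV dW db ph'(4) by auto
    obtain e where e: "e \<in> A" "E e x0"
      by (rule separator_adjacent[OF XV _ clA A0, of x0]) (use x0 in \<open>auto simp: card_insert_if\<close>)
    have "e \<noteq> d" using e nE E_sym by auto
    hence "E d e" using clq d e by (auto simp: clique_def)
    moreover have "x0 \<noteq> d" using AV d x0 by auto
    ultimately have "pair x0 d b e" using e nE bL x0W dW E_sym by (auto simp: pair_def)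
    hence "P x0 d" using x0W dW e AW by (auto simp: P_def)
    from PM[OF this ph'(1,4) db] show False using ne' by blast
  qed
  let ?R = "reduced L {u,y,x,z} (F x z)"
  obtain d0 where d0: "d0 \<in> A" using A0 by blast
  \<comment> \<open>As \<open>\<phi>'\<close> avoids \<open>b\<close> on \<open>A\<close>, its
    colors there lie in the common reduced list, which has only \<open>card A - 1\<close> elements,
    while a clique needs \<open>card A\<close>.\<close>
  have "\<phi>' d \<in> ?R d0" if d: "d \<in> A" for d
  proof -
    have dV: "d \<in> V" using d AV by auto
    have "F x z a \<noteq> \<phi>' d" if a: "a \<in> nbrs {u,y,x,z} d" for a
    proof -
      have Ed: "E d a" "a \<in> {u,y,x,z}" using a by (auto simp: nbrs_def)
      show ?thesis
      proof (cases "a \<in> {u,y}")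
        case True
        hence "F x z a = \<phi>' a" using Fv[OF Pxz] ph' by auto
        moreover have "\<phi>' d \<noteq> \<phi>' a" using list_coloringD(2)[OF ph'(1) dV _ Ed(1)] E_V2[OF Ed(1)] by blast
        ultimately show ?thesis by simp
      next
        case False
        hence "F x z a = b" using Ed Fv[OF Pxz] by auto
        thus ?thesis using nb[OF d] by simp
      qed
    qed
    hence "\<phi>' d \<notin> F x z ` nbrs {u,y,x,z} d" by (metis imageE)
    hence "\<phi>' d \<in> ?R d" using list_coloringD(1)[OF ph'(1) dV] by (simp add: reduced_def)
    thus ?thesis using stuck_clique_lists[OF st XV clq d0 d] by simp
  qed
  hence "\<phi>' ` A \<subseteq> ?R d0" by blast
  moreover have "finite (?R d0)" using finite_L[of d0] d0 AV by (auto simp: reduced_def)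
  moreover have "inj_on \<phi>' A"
  proof (rule inj_onI, rule ccontr)
    fix a d assume "a \<in> A" "d \<in> A" "\<phi>' a = \<phi>' d" "a \<noteq> d"
    thus False using clq list_coloringD(2)[OF ph'(1), of a d] AV by (auto simp: clique_def)
  qed
  ultimately have "card A \<le> card (?R d0)" by (metis card_image card_mono)
  also have "\<dots> = card (nbrs A d0)" by (rule stuck_card[OF st XV d0])
  also have "\<dots> < card A"
    using d0 E_irrefl by (intro psubset_card_mono finA) (auto simp: nbrs_def)
  finally show False by simp
qed

text \<open>Every coloring has a pattern around this same \<open>v\<close>, which therefore stays
  uncolored and provides the defect. The remaining conflicts are a shared vertex \<open>u\<close>
  and, between singles, the shared color \<open>c\<close>; a pair at \<open>v\<close> has its color
  in \<open>L v\<close> and so avoids \<open>c\<close>.\<close>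

theorem single_all_equiv:
  assumes p: "single u c v" and "col \<phi>" "col \<psi>" shows "\<phi> \<approx> \<psi>"
proof -
  obtain \<chi> where x: "col \<chi>" "\<chi> u = c" using single_exists[OF p] by blast
  note sp = singleD[OF p]
  have "\<chi> \<approx> \<rho>" if r: "col \<rho>" for \<rho>
  proof -
    have "v \<in> V" using sp by simp
    with r show ?thesis
    proof (cases rule: exists_pattern)
      case (single x)
      show ?thesis
      proof (cases "u = x")
        case True
        show ?thesis by (rule same_vertex_singles[OF p single[folded True] x r refl])
      next
        case ux: False
        show ?thesis
        proof (cases "\<rho> x = c")
          case True
          show ?thesis by (rule same_color_singles[OF p single[unfolded True] x r True])
        next
          case False
          show ?thesis by (rule link_single_single[OF p single ux]) (use False x r singleD[OF single] in auto)
        qed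
      qed
    next
      case (pair x y)
      note pd = pairD[OF pair(1)]
      consider "u = x" | "u = y" | "u \<noteq> x" "u \<noteq> y" by blast
      thus ?thesis
      proof cases
        case 1
        show ?thesis by (rule single_vs_pair[OF p pair(1)[folded 1] _ x r]) (use pair 1 in auto)
      next
        case 2
        have "pair u x (\<rho> x) v" using pair_sym[OF pair(1)] 2 by simp
        thus ?thesis by (rule single_vs_pair[OF p _ _ x r]) (use pair 2 in auto)
      next
        case 3
        show ?thesis by (rule link_single_pair[OF p pair(1) 3]) (use pair x r pd sp in auto)
      qed
    qed
  qed
  hence "\<chi> \<approx> \<phi>" "\<chi> \<approx> \<psi>" using assms by auto
  thus ?thesis using rtranclp_trans swap_equiv_sym by metis
qed

end

subsection \<open>Regular graphs with a common list\<close>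

locale uniform_lists = tight_lists V E L
  for V :: "'a set" and E and L :: "'a \<Rightarrow> 'c set" +
  fixes K :: "'c set"
  assumes L_K: "v \<in> V \<Longrightarrow> L v = K"
begin

definition dist2 :: "'a \<Rightarrow> 'a \<Rightarrow> bool" where
  "dist2 x y \<longleftrightarrow> x \<noteq> y \<and> \<not> E x y \<and> (\<exists>v. E x v \<and> E y v)"

text \<open>By \<open>mono_equiv\<close> the colorings that agree on a pair at distance two lie in
  one class; two such pairs are related if their classes coincide.\<close>

definition linked :: "'a \<Rightarrow> 'a \<Rightarrow> 'a \<Rightarrow> 'a \<Rightarrow> bool" where
  "linked x y s t \<longleftrightarrow> (\<forall>\<phi> \<psi>. col \<phi> \<longrightarrow> col \<psi> \<longrightarrow> \<phi> x = \<phi> y \<longrightarrow> \<psi> s = \<psi> t \<longrightarrow> \<phi> \<approx> \<psi>)"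

lemma dist2D: "dist2 x y \<Longrightarrow> x \<in> V \<and> y \<in> V \<and> x \<noteq> y \<and> \<not> E x y \<and> \<not> E y x"
  unfolding dist2_def using E_V E_sym by blast

lemma dist2_sym: "dist2 x y \<Longrightarrow> dist2 y x"
  unfolding dist2_def using E_sym by blast

lemma dist2_pair: assumes "dist2 x y" "c \<in> K" obtains v where "pair x y c v"
  using assms dist2D[OF assms(1)] L_K unfolding dist2_def pair_def by auto

lemma card_K: "v \<in> V \<Longrightarrow> card (nbrs V v) = card K" and finite_K: "finite K" and card_K_ge: "card K \<ge> 4"
proof -
  show *: "v \<in> V \<Longrightarrow> card (nbrs V v) = card K" for v using card_L L_K by metis
  obtain v where "v \<in> V" using card_V by fastforce
  thus "finite K" "card K \<ge> 4" using finite_L L_K degree_ge[of v] *[of v] by auto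
qed

lemma color_K: "col \<phi> \<Longrightarrow> v \<in> V \<Longrightarrow> \<phi> v \<in> K"
  using list_coloringD(1) L_K by blast

lemma color_ne: "col \<phi> \<Longrightarrow> E u v \<Longrightarrow> \<phi> u \<noteq> \<phi> v"
  using list_coloringD(2) E_V E_V2 by blast

text \<open>All vertices of the two colors form a union of Kempe chains, and the common list makes
  their exchange valid. Hence the color on a pair does not matter.\<close>

lemma permute_colors:
  assumes "col \<phi>" "a \<in> K" "b \<in> K"
  shows "\<phi> \<approx> (\<lambda>v. transpose a b (\<phi> v))" "col (\<lambda>v. transpose a b (\<phi> v))"
proof -
  have "swap V L \<phi> (\<lambda>v. transpose a b (\<phi> v))"
  proof (rule swapI[OF assms(1), of a b "{v \<in> V. \<phi> v \<in> {a, b}}"])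
    show "swap_closed V \<phi> a b {v \<in> V. \<phi> v \<in> {a, b}}" by (rule swap_closedI) auto
    fix v
    show "transpose a b (\<phi> v) = (if v \<in> {v \<in> V. \<phi> v \<in> {a, b}} then transpose a b (\<phi> v) else \<phi> v)" if "v \<in> V"
      using that by auto
    show "transpose a b (\<phi> v) \<in> L v" if "v \<in> {v \<in> V. \<phi> v \<in> {a, b}}"
      using that assms L_K[of v] by auto
  qed
  thus "\<phi> \<approx> (\<lambda>v. transpose a b (\<phi> v))" by (rule r_into_rtranclp[of "swap V L"])
  thus "col (\<lambda>v. transpose a b (\<phi> v))" using assms(1) by (rule swap_equiv_coloring)
qed

lemma mono_equiv:
  assumes "dist2 x y" "col \<phi>" "col \<psi>" "\<phi> x = \<phi> y" "\<psi> x = \<psi> y"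
  shows "\<phi> \<approx> \<psi>"
proof -
  have K: "\<phi> x \<in> K" "\<psi> x \<in> K" using color_K assms dist2D by blast+
  obtain v where p: "pair x y (\<psi> x) v" using dist2_pair[OF assms(1) K(2)] by blast
  have "(\<lambda>v. transpose (\<phi> x) (\<psi> x) (\<phi> v)) \<approx> \<psi>"
    by (rule pair_equiv[OF p permute_colors(2)[OF assms(2) K] assms(3)]) (use assms in auto)
  with permute_colors(1)[OF assms(2) K] show ?thesis by (rule rtranclp_trans)
qed

lemma mono_exists: assumes "dist2 x y" obtains \<phi> where "col \<phi>" "\<phi> x = \<phi> y"
proof -
  obtain c where "c \<in> K" using card_K_ge by fastforce
  then obtain v where "pair x y c v" using dist2_pair[OF assms] by blast
  thus ?thesis using pair_exists that by metis
qed

lemma linked_via: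
  assumes "dist2 x y" "dist2 s t" "col \<chi>" "\<chi> x = \<chi> y" "\<chi> s = \<chi> t"
  shows "linked x y s t"
  unfolding linked_def
proof (intro allI impI)
  fix \<phi> \<psi> assume "col \<phi>" "col \<psi>" "\<phi> x = \<phi> y" "\<psi> s = \<psi> t"
  hence "\<phi> \<approx> \<chi>" "\<chi> \<approx> \<psi>" using mono_equiv assms by blast+
  thus "\<phi> \<approx> \<psi>" by (rule rtranclp_trans)
qed

lemma linked_sym: "linked x y s t \<Longrightarrow> linked s t x y"
  unfolding linked_def using swap_equiv_sym by blast

lemma linked_swap: "linked x y s t \<Longrightarrow> linked y x s t" "linked x y s t \<Longrightarrow> linked x y t s"
  unfolding linked_def by metis+

lemma linked_trans:
  assumes "dist2 e h" "linked x y e h" "linked e h s t" shows "linked x y s t"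
proof -
  obtain \<chi> where "col \<chi>" "\<chi> e = \<chi> h" using mono_exists[OF assms(1)] by blast
  thus ?thesis using assms(2,3) unfolding linked_def by (meson rtranclp_trans)
qed

section \<open>Disjoint pairs that cannot be realized together\<close>

definition two_colors :: "'a \<Rightarrow> 'a \<Rightarrow> 'c \<Rightarrow> 'c \<Rightarrow> 'a \<Rightarrow> 'c" where
  "two_colors x y a b = (\<lambda>_. b)(x := a, y := a)"

text \<open>The obstruction \<open>A\<close> is an argument so that it can be minimized over all
  pairs and colors at once.\<close>

definition bad :: "'a \<Rightarrow> 'a \<Rightarrow> 'a \<Rightarrow> 'a \<Rightarrow> 'c \<Rightarrow> 'c \<Rightarrow> 'a set \<Rightarrow> bool" where
  "bad x y s t a b A \<longleftrightarrow> dist2 x y \<and> dist2 s t \<and> {x, y} \<inter> {s, t} = {} \<and> \<not> linked x y s t \<and>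
     a \<in> K \<and> b \<in> K \<and> a \<noteq> b \<and> stuck {x, y, s, t} (two_colors x y a b) A"

lemma stuck_cong:
  assumes "\<And>x. x \<in> X \<Longrightarrow> f x = g x" shows "stuck X f A = stuck X g A"
proof -
  have "f ` nbrs X v = g ` nbrs X v" for v by (rule image_cong) (auto simp: nbrs_def assms)
  hence "reduced L X f = reduced L X g" by (simp add: reduced_def fun_eq_iff)
  thus ?thesis by (simp add: stuck_def)
qed

lemma bad_sym_pairs: assumes "bad x y s t a b A" shows "bad s t x y b a A"
proof -
  have 1: "{x, y, s, t} = {s, t, x, y}" by auto
  have "stuck {s, t, x, y} (two_colors x y a b) A" using assms 1 by (simp add: bad_def)
  moreover have "two_colors x y a b z = two_colors s t b a z" if "z \<in> {s, t, x, y}" for z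
    using assms that by (auto simp: bad_def two_colors_def)
  ultimately have "stuck {s, t, x, y} (two_colors s t b a) A"
    using stuck_cong[of "{s, t, x, y}" "two_colors x y a b" "two_colors s t b a"] by blast
  moreover have "\<not> linked s t x y" using assms linked_sym unfolding bad_def by blast
  moreover have "{s, t} \<inter> {x, y} = {}" "b \<noteq> a" using assms unfolding bad_def by blast+
  ultimately show ?thesis using assms unfolding bad_def by blast
qed

lemma bad_sym_right: assumes "bad x y s t a b A" shows "bad x y t s a b A"
proof -
  have "{x, y, s, t} = {x, y, t, s}" by auto
  moreover have "\<not> linked x y t s" using assms linked_swap(2) unfolding bad_def by blast
  moreover have "dist2 t s" using assms dist2_sym unfolding bad_def by blast
  moreover have "{x, y} \<inter> {t, s} = {}" using assms unfolding bad_def by blast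
  ultimately show ?thesis using assms unfolding bad_def by metis
qed

lemma bad_sym_left: "bad x y s t a b A \<Longrightarrow> bad y x s t a b A"
  by (rule bad_sym_pairs[OF bad_sym_right[OF bad_sym_pairs]])

lemma badD:
  assumes "bad x y s t a b A"
  shows "{x, y, s, t} \<subseteq> V" "x \<noteq> y" "s \<noteq> t" "x \<notin> {s, t}" "y \<notin> {s, t}" "\<not> E x y" "\<not> E s t"
    "stuck {x, y, s, t} (two_colors x y a b) A" "closed_in (V - {x, y, s, t}) A" "A \<noteq> {}" "connected_on A"
    "A \<subseteq> V - {x, y, s, t}" "finite A" "dist2 x y" "dist2 s t" "\<not> linked x y s t" "a \<in> K" "b \<in> K" "a \<noteq> b"
proof -
  show s: "stuck {x, y, s, t} (two_colors x y a b) A" and d: "dist2 x y" "dist2 s t"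
    and "\<not> linked x y s t" "a \<in> K" "b \<in> K" "a \<noteq> b"
    using assms by (auto simp: bad_def)
  show "{x, y, s, t} \<subseteq> V" "x \<noteq> y" "s \<noteq> t" "x \<notin> {s, t}" "y \<notin> {s, t}" "\<not> E x y" "\<not> E s t"
    using dist2D[OF d(1)] dist2D[OF d(2)] assms by (auto simp: bad_def)
  show "closed_in (V - {x, y, s, t}) A" "A \<noteq> {}" "connected_on A" using s by (auto simp: stuck_def)
  show "A \<subseteq> V - {x, y, s, t}" "finite A" using stuck_subset[OF s] by auto
qed

lemma bad_exists:
  assumes "dist2 x y" "dist2 s t" "{x, y} \<inter> {s, t} = {}" "\<not> linked x y s t" "a \<in> K" "b \<in> K" "a \<noteq> b"
  obtains A where "bad x y s t a b A"
proof -
  note d = dist2D[OF assms(1)] dist2D[OF assms(2)]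
  let ?f = "two_colors x y a b"
  have f: "?f x = a" "?f y = a" "?f s = b" "?f t = b" using assms(3) by (auto simp: two_colors_def)
  have "list_coloring {x, y, s, t} L ?f"
  proof (rule list_coloringI)
    fix u assume u: "u \<in> {x, y, s, t}"
    thus "?f u \<in> L u" using f L_K[of u] d assms by auto
    fix v assume "v \<in> {x, y, s, t}" "E u v"
    thus "?f u \<noteq> ?f v" using u f assms(7) d E_irrefl by (elim insertE) auto
  qed
  moreover have "\<not> (\<exists>\<phi>. col \<phi> \<and> (\<forall>z\<in>{x, y, s, t}. \<phi> z = ?f z))"
  proof
    assume "\<exists>\<phi>. col \<phi> \<and> (\<forall>z\<in>{x, y, s, t}. \<phi> z = ?f z)"
    then obtain \<phi> where "col \<phi>" "\<phi> x = \<phi> y" "\<phi> s = \<phi> t" using f by auto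
    thus False using linked_via[OF assms(1,2)] assms(4) by blast
  qed
  ultimately obtain A where "stuck {x, y, s, t} ?f A" by (rule stuck_exists)
  thus ?thesis using that assms unfolding bad_def by blast
qed

lemma two_colors_simps:
  assumes "bad x y s t a b A"
  shows "two_colors x y a b x = a" "two_colors x y a b y = a" "two_colors x y a b s = b" "two_colors x y a b t = b"
  using badD(4,5)[OF assms] by (auto simp: two_colors_def)

lemma bad_common_nbr:
  assumes "bad x y s t a b A" "E x v" "E y v" shows "v \<notin> A"
proof -
  have "defect L {x, y, s, t} (two_colors x y a b) v"
    by (rule defectI2[of x _ y]) (use badD(2)[OF assms(1)] two_colors_simps[OF assms(1)] assms E_sym in auto)
  thus ?thesis using stuck_no_defect[OF badD(8,1)[OF assms(1)]] by blast
qed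

text \<open>A common neighbor of \<open>x\<close> and \<open>y\<close> has a defect in both
  configurations, so it lies in neither obstruction; this is the vertex that
  \<open>smaller_closed_part\<close> asks for.\<close>

lemma bad_smaller:
  assumes bd: "bad x y s t a b A" and e: "e \<in> A" "h \<in> A" "dist2 e h" "\<not> linked x y e h"
  obtains B where "bad x y e h a b B" "card B < card A"
proof -
  note D = badD[OF bd]
  have "{x, y} \<inter> {e, h} = {}" using e D(12) by auto
  then obtain B where B: "bad x y e h a b B" using bad_exists[OF D(14) e(3) _ e(4) D(17-19)] by blast
  obtain v where v: "E x v" "E y v" using D(14) by (auto simp: dist2_def)
  have "card B < card A"
  proof (rule smaller_closed_part[OF D(1,3) _ _ D(9) e(1,2)])
    show "closed_in (V - {x, y, e, h}) B" by (rule badD(9)[OF B])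
    show "v \<notin> A" "v \<notin> B" using bad_common_nbr[OF bd v] bad_common_nbr[OF B v] by auto
    show "v \<in> V" using v E_V2 by blast
    show "v \<notin> {x, y}" using v E_irrefl by auto
    show "e \<noteq> h" using e(3) by (simp add: dist2_def)
  qed (use D(4,5) in auto)
  thus ?thesis using B that by blast
qed

lemma bad_clique_exists:
  assumes "bad x y s t a b A"
  obtains x' y' s' t' a' b' A' where "bad x' y' s' t' a' b' A'" "clique A'"
proof -
  let ?Q = "\<lambda>A. \<exists>x y s t a b. bad x y s t a b A"
  obtain A' where Q: "?Q A'" and min: "\<And>B. ?Q B \<Longrightarrow> card A' \<le> card B"
    using ex_has_least_nat[of ?Q A card] assms by blast
  obtain x y s t a b where bd: "bad x y s t a b A'" using Q by blast
  have "clique A'"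
  proof (rule ccontr)
    assume "\<not> clique A'"
    then obtain e g h where P3: "e \<in> A'" "g \<in> A'" "h \<in> A'" "E e g" "E h g" "e \<noteq> h" "\<not> E e h"
      by (rule induced_path[OF badD(11)[OF bd]])
    have d: "dist2 e h" using P3 by (auto simp: dist2_def)
    \<comment> \<open>By transitivity the new pair is unlinked from one of the old pairs and can
      replace the other.\<close>
    have "\<not> linked x y e h \<or> \<not> linked s t e h"
      using badD(16)[OF bd] linked_trans[OF d] linked_sym by blast
    thus False
    proof
      assume "\<not> linked x y e h"
      then obtain B where "bad x y e h a b B" "card B < card A'"
        by (rule bad_smaller[OF bd P3(1,3) d])
      thus False using min[of B] by fastforce
    next
      assume "\<not> linked s t e h"
      then obtain B where "bad s t e h b a B" "card B < card A'"
        by (rule bad_smaller[OF bad_sym_pairs[OF bd] P3(1,3) d])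
      thus False using min[of B] by fastforce
    qed
  qed
  thus ?thesis using that bd by blast
qed

lemma bad_adjacent:
  assumes "bad x y s t a b A" "z \<in> {x, y, s, t}"
  obtains d where "d \<in> A" "E d z"
proof (rule separator_adjacent[OF badD(1)[OF assms(1)] _ badD(9,10)[OF assms(1)] assms(2)])
  show "card {x, y, s, t} \<le> 4" by (simp add: card_insert_if)
qed (use that in blast)

text \<open>Color \<open>a\<close> is blocked at a vertex next to \<open>x\<close>, hence in the
  common reduced list of the whole clique, and only \<open>x\<close> and \<open>y\<close> can block
  it. Seeing both would be a defect.\<close>

lemma bad_clique_left:
  assumes bd: "bad x y s t a b A" and cl: "clique A" and d: "d \<in> A"
  shows "E d x \<noteq> E d y"
proof -
  note D = badD[OF bd]
  let ?f = "two_colors x y a b" and ?X = "{x, y, s, t}"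
  note f = two_colors_simps[OF bd]
  obtain d1 where d1: "d1 \<in> A" "E d1 x" using bad_adjacent[OF bd, of x] by blast
  have "a \<in> ?f ` nbrs ?X d1" using d1 f by (intro image_eqI[of _ _ x]) (auto simp: nbrs_def)
  hence "a \<notin> reduced L ?X ?f d1" by (simp add: reduced_def)
  hence "a \<notin> reduced L ?X ?f d" using stuck_clique_lists[OF D(8,1) cl d1(1) d] by simp
  moreover have "a \<in> L d" using L_K[of d] d D(12,17) by auto
  ultimately obtain z where z: "z \<in> nbrs ?X d" "?f z = a" by (auto simp: reduced_def)
  hence "z \<in> {x, y}" using f D(19) by (auto simp: nbrs_def)
  hence "E d x \<or> E d y" using z by (auto simp: nbrs_def)
  moreover have "\<not> (E d x \<and> E d y)" using bad_common_nbr[OF bd, of d] d E_sym by blast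
  ultimately show ?thesis by blast
qed

lemma bad_clique_nbrs:
  assumes bd: "bad x y s t a b A" and cl: "clique A" and d: "d \<in> A"
  shows "E d x \<noteq> E d y" "E d s \<noteq> E d t"
  using bad_clique_left[OF bd cl d] bad_clique_left[OF bad_sym_pairs[OF bd] cl d] by auto

text \<open>A vertex of the clique has \<open>card A - 1\<close> neighbors inside and one in either
  pair; by regularity this adds up to \<open>card K\<close>.\<close>

lemma bad_clique_card:
  assumes bd: "bad x y s t a b A" and cl: "clique A"
  shows "Suc (card A) = card K"
proof -
  note D = badD[OF bd]
  obtain d where d: "d \<in> A" using D(10) by blast
  have dV: "d \<in> V" using d D(12) by blast
  have sub: "{x, y, s, t} \<subseteq> V" by (rule D(1))
  have "nbrs (V - {x, y, s, t}) d = nbrs A d" using stuck_nbrs[OF D(8) d] by simp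
  also have "\<dots> = A - {d}" using cl d E_irrefl by (auto simp: nbrs_def clique_def)
  finally have "card K = card (A - {d}) + card (nbrs {x, y, s, t} d)"
    using card_nbrs_diff[OF sub, of d] card_K[OF dV] by simp
  moreover have "card (nbrs {x, y, s, t} d) = 2"
  proof -
    obtain p where p: "p \<in> {x, y}" "\<And>z. z \<in> {x, y} \<Longrightarrow> E d z \<longleftrightarrow> z = p"
      using bad_clique_nbrs(1)[OF bd cl d] by auto
    obtain r where r: "r \<in> {s, t}" "\<And>z. z \<in> {s, t} \<Longrightarrow> E d z \<longleftrightarrow> z = r"
      using bad_clique_nbrs(2)[OF bd cl d] by auto
    have "nbrs {x, y, s, t} d = {p, r}" using p r by (auto simp: nbrs_def)
    moreover have "p \<noteq> r" using p(1) r(1) D(4,5) by auto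
    ultimately show ?thesis by simp
  qed
  moreover have "Suc (card (A - {d})) = card A" by (rule card_Suc_Diff1[OF D(13) d])
  ultimately show ?thesis by simp
qed

lemma clique_inj: assumes "col \<phi>" "clique A" shows "inj_on \<phi> A"
proof (rule inj_onI, rule ccontr)
  fix a d assume ad: "a \<in> A" "d \<in> A" "\<phi> a = \<phi> d" "a \<noteq> d"
  hence "E a d" using assms(2) by (auto simp: clique_def)
  thus False using color_ne[OF assms(1)] ad(3) by blast
qed

lemma bad_mono_coloring:
  assumes bd: "bad x y s t a b A"
  obtains \<phi> where "col \<phi>" "\<phi> x = \<phi> y" "\<phi> s \<noteq> \<phi> x"
proof (cases "E s x \<or> E s y")
  case True
  obtain \<phi> where p: "col \<phi>" "\<phi> x = \<phi> y" using mono_exists[OF badD(14)[OF bd]] by blast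
  have "\<phi> s \<noteq> \<phi> x" using True color_ne[OF p(1), of s] p(2) by metis
  thus ?thesis using that p by blast
next
  case False
  note D = badD[OF bd]
  obtain v where v: "pair x y a v" by (rule dist2_pair[OF D(14,17)])
  have "s \<noteq> v" using False pairD[OF v] E_sym by blast
  then obtain \<phi> where "col \<phi>" "\<phi> x = a" "\<phi> y = a" "\<phi> s = b"
    using pair_extends[OF v, of s b] D L_K[of s] by auto
  thus ?thesis using that D(19) by metis
qed

text \<open>When \<open>x\<close> and \<open>y\<close> share a color, the clique uses all other colors, in particular that of \<open>s\<close>;
  it is moved to \<open>d\<close> by exchanging the colors of two vertices of the clique.\<close>

lemma bad_clique_linked:
  assumes bd: "bad x y s t a b A" and cl: "clique A" and d: "d \<in> A" "\<not> E s d"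
  shows "linked x y s d"
proof -
  note D = badD[OF bd]
  obtain \<phi> where p: "col \<phi>" "\<phi> x = \<phi> y" "\<phi> s \<noteq> \<phi> x" by (rule bad_mono_coloring[OF bd])
  have st: "\<phi> s \<noteq> \<phi> t" using linked_via[OF D(14,15) p(1,2)] D(16) by blast
  have AV: "A \<subseteq> V" using D(12) by blast
  have nA: "x \<notin> A" "y \<notin> A" "s \<notin> A" "t \<notin> A" using D(12) by auto
  have neX: "\<phi> q \<noteq> \<phi> x" if "q \<in> A" for q
    using bad_clique_nbrs(1)[OF bd cl that] color_ne[OF p(1), of q] p(2) by metis
  have "\<phi> ` A \<subseteq> K - {\<phi> x}"
  proof (rule image_subsetI)
    fix q assume q: "q \<in> A"
    have "\<phi> q \<in> K" by (rule color_K[OF p(1)]) (use q AV in blast)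
    thus "\<phi> q \<in> K - {\<phi> x}" using neX[OF q] by simp
  qed
  moreover have "card (\<phi> ` A) = card (K - {\<phi> x})"
  proof -
    have "card (\<phi> ` A) = card A" by (rule card_image[OF clique_inj[OF p(1) cl]])
    moreover have "\<phi> x \<in> K" using color_K[OF p(1)] D(1) by blast
    ultimately show ?thesis using bad_clique_card[OF bd cl] by simp
  qed
  ultimately have "\<phi> ` A = K - {\<phi> x}" using finite_K by (intro card_subset_eq) auto
  moreover have "\<phi> s \<in> K - {\<phi> x}" using p(3) color_K[OF p(1), of s] D(1) by simp
  ultimately obtain d0 where d0: "d0 \<in> A" "\<phi> d0 = \<phi> s" by (metis imageE)
  have nd0: "\<not> E s d0" using color_ne[OF p(1), of s d0] d0(2) by metis
  have tt: "E d t" "E d0 t"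
    using bad_clique_nbrs(2)[OF bd cl d(1)] bad_clique_nbrs(2)[OF bd cl d0(1)] d(2) nd0 E_sym by blast+
  obtain e where e: "e \<in> A" "E e s" using bad_adjacent[OF bd, of s] by blast
  have ed: "e \<noteq> d" using e d E_sym by blast
  have "E d e" using cl e d ed by (auto simp: clique_def)
  moreover have "s \<noteq> d" using d nA by blast
  ultimately have sd: "dist2 s d" using d e E_sym unfolding dist2_def by blast
  \<comment> \<open>Both \<open>d\<close> and \<open>d0\<close> miss \<open>s\<close>, so outside
    the clique they see \<open>t\<close> and one of \<open>x\<close> and \<open>y\<close>. The
    exchange is proper since neither color occurs there: \<open>\<phi> d0\<close> is the color of
    \<open>s\<close>, which differs from that of \<open>t\<close>, and \<open>d\<close> is adjacent
    to \<open>t\<close>.\<close>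
  define \<chi> where "\<chi> = \<phi>(d := \<phi> d0, d0 := \<phi> d)"
  have xA: "\<chi> q = \<phi> q" if "q \<notin> A" for q using that d d0 by (auto simp: \<chi>_def)
  have xs: "\<chi> d = \<phi> s" using d0 by (auto simp: \<chi>_def)
  have in_or: "q \<in> A \<or> q \<in> {x, y, s, t}" if "p \<in> A" "E p q" for p q
    using D(9) that E_V2[OF that(2)] unfolding closed_in_def by blast
  have k1: "\<phi> d0 \<noteq> \<phi> q" if "E d q" "q \<noteq> d0" for q
  proof -
    have "q \<in> A \<or> q \<in> {x, y} \<or> q = s \<or> q = t" using in_or[OF d(1) that(1)] by blast
    thus ?thesis
    proof (elim disjE)
      assume "q \<in> A"
      hence "E d0 q" using cl d0 that by (auto simp: clique_def)
      thus ?thesis by (rule color_ne[OF p(1)])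
    next
      assume "q \<in> {x, y}"
      hence "\<phi> q = \<phi> x" using p(2) by auto
      thus ?thesis using neX[OF d0(1)] by simp
    next
      assume "q = s" thus ?thesis using that d E_sym by blast
    next
      assume "q = t" thus ?thesis using st d0 by simp
    qed
  qed
  have k2: "\<phi> d \<noteq> \<phi> q" if "E d0 q" "q \<noteq> d" for q
  proof -
    have "q \<in> A \<or> q \<in> {x, y} \<or> q = s \<or> q = t" using in_or[OF d0(1) that(1)] by blast
    thus ?thesis
    proof (elim disjE)
      assume "q \<in> A"
      hence "E d q" using cl d that by (auto simp: clique_def)
      thus ?thesis by (rule color_ne[OF p(1)])
    next
      assume "q \<in> {x, y}"
      hence "\<phi> q = \<phi> x" using p(2) by auto
      thus ?thesis using neX[OF d(1)] by simp
    next
      assume "q = s" thus ?thesis using that nd0 E_sym by blast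
    next
      assume "q = t" thus ?thesis using color_ne[OF p(1) tt(1)] by simp
    qed
  qed
  have k3: "\<chi> p \<noteq> \<chi> q" if pq: "E p q" "p \<in> {d, d0}" for p q
  proof (cases "q \<in> {d, d0}")
    case True
    hence "(p = d \<and> q = d0) \<or> (p = d0 \<and> q = d)" using pq E_irrefl by auto
    moreover from this have "\<phi> d \<noteq> \<phi> d0" using color_ne[OF p(1) pq(1)] by auto
    ultimately show ?thesis by (auto simp: \<chi>_def)
  next
    case False
    hence xq: "\<chi> q = \<phi> q" by (auto simp: \<chi>_def)
    show ?thesis
    proof (cases "p = d0")
      case True
      thus ?thesis using k2[of q] pq False xq by (auto simp: \<chi>_def)
    next
      case False
      thus ?thesis using k1[of q] pq \<open>q \<notin> {d, d0}\<close> xq by (auto simp: \<chi>_def)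
    qed
  qed
  have colx: "col \<chi>"
  proof (rule list_coloringI)
    fix q assume q: "q \<in> V"
    have "d \<in> V" "d0 \<in> V" using d d0 AV by auto
    hence "\<chi> q \<in> K" using q color_K[OF p(1)] by (auto simp: \<chi>_def)
    thus "\<chi> q \<in> L q" using L_K[OF q] by simp
    fix r assume "E q r"
    show "\<chi> q \<noteq> \<chi> r"
    proof (cases "q \<in> {d, d0} \<or> r \<in> {d, d0}")
      case True
      thus ?thesis using k3[of q r] k3[of r q] \<open>E q r\<close> E_sym[OF \<open>E q r\<close>] by metis
    next
      case False
      hence "\<chi> q = \<phi> q" "\<chi> r = \<phi> r" by (auto simp: \<chi>_def)
      thus ?thesis using color_ne[OF p(1) \<open>E q r\<close>] by simp
    qed
  qed
  show ?thesis by (rule linked_via[OF D(14) sd colx]) (use xA nA xs p in auto)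
qed

lemma bad_clique_linked_any:
  assumes bd: "bad x y s t a b A" and cl: "clique A" and "d \<in> A" "\<not> E z d" "z \<in> {s, t}"
  shows "linked x y z d"
  using bad_clique_linked[OF bd cl] bad_clique_linked[OF bad_sym_right[OF bd] cl] assms(3-) by blast

text \<open>Without such an edge, the neighbors \<open>q\<close> in \<open>{x, y}\<close> and
  \<open>z\<close> in \<open>{s, t}\<close> of a clique vertex form a pair that mediates: one color
  fits on \<open>x\<close>, \<open>y\<close>, \<open>z\<close>, and one on \<open>s\<close>,
  \<open>t\<close>, \<open>q\<close>.\<close>

lemma bad_clique_cross_edge:
  assumes bd: "bad x y s t a b A" and cl: "clique A"
  shows "\<exists>z\<in>{s, t}. E z x \<or> E z y"
proof (rule ccontr)
  assume "\<not> ?thesis"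
  hence no: "\<And>z q. z \<in> {s, t} \<Longrightarrow> q \<in> {x, y} \<Longrightarrow> \<not> E z q \<and> \<not> E q z" using E_sym by blast
  note D = badD[OF bd]
  obtain d where d: "d \<in> A" using D(10) by blast
  obtain q where q: "q \<in> {x, y}" "E d q" using bad_clique_nbrs(1)[OF bd cl d] by blast
  obtain z where z: "z \<in> {s, t}" "E d z" using bad_clique_nbrs(2)[OF bd cl d] by blast
  have qz: "q \<noteq> z" using q z D(4,5) by auto
  have d2: "dist2 q z" using qz no[OF z(1) q(1)] q z E_sym unfolding dist2_def by blast
  obtain v where v: "pair x y a v" by (rule dist2_pair[OF D(14,17)])
  have zV: "z \<in> V" "q \<in> V" using z q D(1) by auto
  have "z \<noteq> v" using no[OF z(1), of x] pairD[OF v] by blast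
  moreover have "z \<noteq> x" "z \<noteq> y" using z D(4,5) by auto
  moreover have "a \<in> L z" using L_K[OF zV(1)] D(17) by simp
  moreover have "a \<noteq> a \<or> (\<not> E z x \<and> \<not> E z y)" using no[OF z(1)] by blast
  ultimately obtain \<phi> where p: "col \<phi>" "\<phi> x = a" "\<phi> y = a" "\<phi> z = a"
    using pair_extends[OF v zV(1)] by blast
  have l1: "linked x y q z" by (rule linked_via[OF D(14) d2 p(1)]) (use p q in auto)
  obtain w where w: "pair s t a w" by (rule dist2_pair[OF D(15,17)])
  have "q \<noteq> w" using no[OF _ q(1), of s] pairD[OF w] by blast
  moreover have "q \<noteq> s" "q \<noteq> t" using q D(4,5) by auto
  moreover have "a \<in> L q" using L_K[OF zV(2)] D(17) by simp
  moreover have "a \<noteq> a \<or> (\<not> E q s \<and> \<not> E q t)" using no[OF _ q(1)] by blast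
  ultimately obtain \<psi> where p': "col \<psi>" "\<psi> s = a" "\<psi> t = a" "\<psi> q = a"
    using pair_extends[OF w zV(2)] by blast
  have "linked q z s t" by (rule linked_via[OF d2 D(15) p'(1)]) (use p' z in auto)
  thus False using linked_trans[OF d2 l1] D(16) by blast
qed

text \<open>The cross edge makes one of \<open>s\<close> and \<open>t\<close> differ automatically;
  \<open>bad_mono_coloring\<close> takes care of the other.\<close>

lemma bad_clique_coloring:
  assumes bd: "bad x y s t a b A" and cl: "clique A"
  obtains \<phi> where "col \<phi>" "\<phi> x = \<phi> y" "\<phi> s \<noteq> \<phi> x" "\<phi> t \<noteq> \<phi> x"
proof -
  have *: "\<phi> z \<noteq> \<phi> x" if "col \<phi>" "\<phi> x = \<phi> y" "E z x \<or> E z y" for z \<phi>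
    using color_ne[OF that(1), of z] that(2,3) by metis
  obtain \<phi>1 where 1: "col \<phi>1" "\<phi>1 x = \<phi>1 y" "\<phi>1 s \<noteq> \<phi>1 x" by (rule bad_mono_coloring[OF bd])
  obtain \<phi>2 where 2: "col \<phi>2" "\<phi>2 x = \<phi>2 y" "\<phi>2 t \<noteq> \<phi>2 x"
    by (rule bad_mono_coloring[OF bad_sym_right[OF bd]])
  obtain z where z: "z \<in> {s, t}" "E z x \<or> E z y" using bad_clique_cross_edge[OF bd cl] by blast
  show ?thesis
  proof (cases "z = s")
    case True
    thus ?thesis using that[OF 2(1,2) _ 2(3)] *[OF 2(1,2)] z(2) by blast
  next
    case False
    hence "z = t" using z(1) by blast
    thus ?thesis using that[OF 1] *[OF 1(1,2)] z(2) by blast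
  qed
qed

text \<open>The clique together with \<open>x\<close> and \<open>y\<close> has
  \<open>card K + 1\<close> vertices, so some color repeats, and this can only be between
  \<open>{x, y}\<close> and the clique.\<close>

lemma bad_clique_repeat:
  assumes bd: "bad x y s t a b A" and cl: "clique A" and x: "col \<chi>" "\<chi> x \<noteq> \<chi> y"
  obtains z d where "z \<in> {x, y}" "d \<in> A" "\<chi> z = \<chi> d" "\<not> E z d" "dist2 z d"
proof -
  note D = badD[OF bd]
  have AV: "A \<subseteq> V" using D(12) by blast
  have "\<not> {\<chi> x, \<chi> y} \<inter> \<chi> ` A = {}"
  proof
    assume "{\<chi> x, \<chi> y} \<inter> \<chi> ` A = {}"
    hence "card ({\<chi> x, \<chi> y} \<union> \<chi> ` A) = card {\<chi> x, \<chi> y} + card (\<chi> ` A)"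
      using D(13) by (intro card_Un_disjoint) auto
    moreover have "card (\<chi> ` A) = card A" by (rule card_image[OF clique_inj[OF x(1) cl]])
    moreover have "{\<chi> x, \<chi> y} \<union> \<chi> ` A \<subseteq> K"
    proof -
      have "\<chi> x \<in> K" "\<chi> y \<in> K" using color_K[OF x(1)] D(1) by simp_all
      moreover have "\<chi> ` A \<subseteq> K" by (rule image_subsetI, rule color_K[OF x(1)]) (use AV in blast)
      ultimately show ?thesis by blast
    qed
    hence "card ({\<chi> x, \<chi> y} \<union> \<chi> ` A) \<le> card K" by (rule card_mono[OF finite_K])
    ultimately show False using x(2) bad_clique_card[OF bd cl] by simp
  qed
  then obtain d where d: "d \<in> A" "\<chi> d \<in> {\<chi> x, \<chi> y}" by auto
  then obtain z where z: "z \<in> {x, y}" "\<chi> z = \<chi> d" by (metis insertE insertI1 insertI2 singletonD)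
  have nE: "\<not> E z d" using color_ne[OF x(1), of z d] z(2) by blast
  obtain e where e: "e \<in> A" "E e z" using bad_adjacent[OF bd, of z] z by blast
  have ed: "e \<noteq> d" using e nE E_sym by blast
  have "E d e" using cl e d ed by (auto simp: clique_def)
  moreover have "z \<noteq> d" using d z D(12) by auto
  ultimately have "dist2 z d" using nE e E_sym unfolding dist2_def by blast
  thus ?thesis using that z d nE by blast
qed

text \<open>\<open>x\<close> has a free color outside the clique, and the clique can be recolored after using it.
  The clique misses just one color, so it repeats a color of \<open>{x, y}\<close> and one of \<open>{s, t}\<close>.\<close>

lemma bad_clique_two_nbrs:
  assumes bd: "bad x y s t a b A" and cl: "clique A" and two: "card (nbrs A x) \<ge> 2"
  shows False
proof -
  note D = badD[OF bd]
  obtain \<phi> where p: "col \<phi>" "\<phi> x = \<phi> y" "\<phi> s \<noteq> \<phi> x" "\<phi> t \<noteq> \<phi> x" by (rule bad_clique_coloring[OF bd cl])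
  have st: "\<phi> s \<noteq> \<phi> t" using linked_via[OF D(14,15) p(1,2)] D(16) by blast
  have V4: "x \<in> V" "y \<in> V" "s \<in> V" "t \<in> V" using D(1) by auto
  have AV: "A \<subseteq> V" using D(12) by blast
  have nA: "x \<notin> A" "y \<notin> A" "s \<notin> A" "t \<notin> A" using D(12) by auto
  let ?N = "nbrs (V - A) x"
  \<comment> \<open>At least two neighbors of \<open>x\<close> lie in the clique, so the outer ones
    and \<open>x\<close> itself use at most \<open>card K - 1\<close> colors.\<close>
  have "card K = card ?N + card (nbrs A x)" using card_nbrs_diff[OF AV, of x] card_K[OF V4(1)] by simp
  moreover have "card (insert (\<phi> x) (\<phi> ` ?N)) \<le> Suc (card ?N)"
    using card_image_le[OF finite_nbrs, of \<phi> "V - A" x] by (simp add: card_insert_if finite_nbrs)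
  ultimately have "card (insert (\<phi> x) (\<phi> ` ?N)) < card K" using two by linarith
  then obtain g where g: "g \<in> K" "g \<notin> insert (\<phi> x) (\<phi> ` ?N)"
    by (rule exists_not_in_finite[rotated]) (auto simp: finite_nbrs)
  obtain d1 where d1: "d1 \<in> A" "E d1 y" using bad_adjacent[OF bd, of y] by blast
  obtain d2 where d2: "d2 \<in> A" "E d2 x" using bad_adjacent[OF bd, of x] by blast
  have d2y: "\<not> E d2 y" using bad_clique_nbrs(1)[OF bd cl d2(1)] d2 by blast
  have d12: "d1 \<noteq> d2" using d1 d2y by blast
  \<comment> \<open>\<open>d2\<close> takes the color that \<open>x\<close> gives up. Then
    \<open>d1\<close> sees this color on both \<open>y\<close> and \<open>d2\<close>, the defect
    that allows the rest of the clique to be recolored.\<close>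
  define f where "f = \<phi>(x := g, d2 := \<phi> x)"
  have fv: "f x = g" "f y = \<phi> x" "f s = \<phi> s" "f t = \<phi> t" "f d2 = \<phi> x"
    using D(2,4) nA d2 p(2) by (auto simp: f_def)
  let ?X = "insert d2 (V - A)"
  have in_or: "q \<in> A \<or> q \<in> {x, y, s, t}" if "E d2 q" for q
    using D(9) that d2(1) E_V2[OF that] unfolding closed_in_def by blast
  have e1: "f d2 \<noteq> f q" if "E d2 q" "q \<in> ?X" for q
  proof -
    have "q \<notin> A" using that E_irrefl by auto
    hence "q \<in> {x, y, s, t}" using in_or[OF that(1)] by blast
    thus ?thesis using that(1) d2y fv g p by auto
  qed
  have e2: "f x \<noteq> f q" if "E x q" "q \<in> V - A" for q
  proof -
    have "q \<in> ?N" using that by (simp add: nbrs_def)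
    hence "\<phi> q \<noteq> g" using g by blast
    moreover have "q \<noteq> x" "q \<noteq> d2" using that E_irrefl d2 by auto
    ultimately show ?thesis using fv by (auto simp: f_def)
  qed
  have lf: "list_coloring ?X L f"
  proof (rule list_coloringI)
    fix q assume q: "q \<in> ?X"
    have qV: "q \<in> V" using q d2 AV by auto
    have "f q \<in> K" using color_K[OF p(1) qV] color_K[OF p(1) V4(1)] g by (auto simp: f_def)
    thus "f q \<in> L q" using L_K[OF qV] by simp
    fix r assume r: "r \<in> ?X" "E q r"
    have rq: "E r q" using E_sym r by blast
    consider "q = d2" | "r = d2" | "q \<noteq> d2" "r \<noteq> d2" "q = x" | "q \<noteq> d2" "r \<noteq> d2" "r = x"
      | "q \<noteq> d2" "r \<noteq> d2" "q \<noteq> x" "r \<noteq> x" by blast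
    thus "f q \<noteq> f r"
    proof cases
      case 1 thus ?thesis using e1 r by blast
    next
      case 2 thus ?thesis using e1[of q] rq q by metis
    next
      case 3 thus ?thesis using e2 r by blast
    next
      case 4 thus ?thesis using e2[of q] rq q by fastforce
    next
      case 5
      thus ?thesis using color_ne[OF p(1) r(2)] by (simp add: f_def)
    qed
  qed
  have "\<exists>\<chi>. col \<chi> \<and> (\<forall>z\<in>?X. \<chi> z = f z)"
  proof (rule precoloring_extends[OF finite_V degree_lists_L _ lf])
    show "?X \<subseteq> V" using d2 AV by auto
    fix B assume B: "closed_in (V - ?X) B" "B \<noteq> {}"
    have VX: "V - ?X = A - {d2}" using AV by auto
    obtain q where q: "q \<in> B" using B by blast
    have "d1 \<in> B"
    proof (rule ccontr)
      assume n: "d1 \<notin> B"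
      have "q \<in> A - {d2}" using q B VX by (auto simp: closed_in_def)
      hence "E q d1" using cl n q d1 by (auto simp: clique_def)
      moreover have "d1 \<in> A - {d2} - B" using d1 d12 n by blast
      ultimately show False using B q VX unfolding closed_in_def by blast
    qed
    moreover have "defect L ?X f d1"
    proof (rule defectI2[of y _ d2])
      show "E d1 d2" using cl d1 d2 d12 by (auto simp: clique_def)
      show "y \<noteq> d2" using nA d2 by blast
    qed (use d1 V4 nA fv in auto)
    ultimately show "\<exists>v\<in>B. defect L ?X f v" by blast
  qed
  then obtain \<chi> where x: "col \<chi>" "\<And>z. z \<in> ?X \<Longrightarrow> \<chi> z = f z" by blast
  have xv: "\<chi> x = g" "\<chi> y = \<phi> x" "\<chi> s = \<phi> s" "\<chi> t = \<phi> t" using x(2) V4 nA fv by auto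
  have xy: "\<chi> x \<noteq> \<chi> y" using xv g by simp
  have st': "\<chi> s \<noteq> \<chi> t" using xv st by simp
  obtain z d where z: "z \<in> {x, y}" "d \<in> A" "\<chi> z = \<chi> d" "\<not> E z d"
    by (rule bad_clique_repeat[OF bd cl x(1) xy])
  obtain z' d' where z': "z' \<in> {s, t}" "d' \<in> A" "\<chi> z' = \<chi> d'" "\<not> E z' d'"
    by (rule bad_clique_repeat[OF bad_sym_pairs[OF bd] cl x(1) st'])
  \<comment> \<open>\<open>\<chi>\<close> realizes both repeated pairs, so it is equivalent to the
    colorings of either original pair.\<close>
  have "linked x y z' d'" by (rule bad_clique_linked_any[OF bd cl z'(2,4,1)])
  moreover have "linked s t z d" by (rule bad_clique_linked_any[OF bad_sym_pairs[OF bd] cl z(2,4,1)])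
  ultimately have "linked x y s t"
    unfolding linked_def using x(1) z(3) z'(3) equiv_via by blast
  thus False using D(16) by blast
qed

text \<open>The clique has \<open>card K - 1\<close>, hence at least three, vertices, each seeing
  \<open>x\<close> or \<open>y\<close>; so one of these two has two neighbors in it.\<close>

lemma disjoint_linked:
  assumes "dist2 x y" "dist2 s t" "{x, y} \<inter> {s, t} = {}"
  shows "linked x y s t"
proof (rule ccontr)
  assume nl: "\<not> linked x y s t"
  obtain a where a: "a \<in> K" using card_K_ge by fastforce
  have "card {a} < card K" using card_K_ge by simp
  then obtain b where b: "b \<in> K" "b \<notin> {a}" by (rule exists_not_in_finite[rotated]) auto
  obtain A0 where "bad x y s t a b A0" using bad_exists[OF assms nl a b(1)] b by blast
  then obtain x y s t a b A where bd: "bad x y s t a b A" and cl: "clique A" by (rule bad_clique_exists)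
  note D = badD[OF bd]
  have "A \<subseteq> nbrs A x \<union> nbrs A y"
    using bad_clique_nbrs(1)[OF bd cl] E_sym by (auto simp: nbrs_def)
  hence "card A \<le> card (nbrs A x \<union> nbrs A y)" by (intro card_mono) (auto simp: finite_nbrs)
  also have "\<dots> \<le> card (nbrs A x) + card (nbrs A y)" by (rule card_Un_le)
  finally have "card (nbrs A x) \<ge> 2 \<or> card (nbrs A y) \<ge> 2"
    using bad_clique_card[OF bd cl] card_K_ge by linarith
  thus False using bad_clique_two_nbrs[OF bd cl] bad_clique_two_nbrs[OF bad_sym_left[OF bd] cl] by blast
qed

text \<open>A pair in \<open>W\<close>, disjoint from both, mediates. If \<open>W\<close> were a
  clique, regularity would make it the neighborhood of \<open>x\<close> and use up all degrees,
  leaving \<open>y\<close> at most the neighbor \<open>b\<close>.\<close>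

lemma shared_linked:
  assumes "dist2 x y" "dist2 x b" shows "linked x y x b"
proof -
  note d = dist2D[OF assms(1)] dist2D[OF assms(2)]
  define W where "W = V - {x, y, b}"
  have cW: "connected_on W" unfolding W_def by (rule conn[OF _ card_le3(3)]) (use d in auto)
  have "\<not> clique W"
  proof
    assume cl: "clique W"
    have finW: "finite W" using finite_V by (simp add: W_def)
    have nx: "nbrs V x \<subseteq> W" using d E_irrefl by (auto simp: nbrs_def W_def)
    have big: "insert x (W - {a}) \<subseteq> nbrs V a" "card (insert x (W - {a})) = card W" if "a \<in> nbrs V x" for a
    proof -
      have a: "a \<in> W" "E x a" using that nx by (auto simp: nbrs_def)
      show "insert x (W - {a}) \<subseteq> nbrs V a"
        using cl a E_sym d by (auto simp: nbrs_def clique_def W_def)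
      show "card (insert x (W - {a})) = card W"
        using finW card_Suc_Diff1[OF finW a(1)] by (simp add: W_def)
    qed
    have cx: "card (nbrs V x) = card K" using card_K d by blast
    hence "nbrs V x \<noteq> {}" using card_K_ge by auto
    then obtain a where a: "a \<in> nbrs V x" by blast
    hence "a \<in> V" by (simp add: nbrs_def)
    have "card W \<le> card (nbrs V a)" using big[OF a] card_mono[OF finite_nbrs] by metis
    hence WK: "card W \<le> card K" using card_K[OF \<open>a \<in> V\<close>] by simp
    hence nxW: "nbrs V x = W" using cx nx finW by (intro card_seteq) auto
    hence cW: "card W = card K" using cx by simp
    have "\<not> E y a" if "a \<in> W" for a
    proof
      assume "E y a"
      have "a \<in> V" using that by (simp add: W_def)
      have "insert x (W - {a}) = nbrs V a"
        using big[of a] that nxW card_K[OF \<open>a \<in> V\<close>] cW by (intro card_subset_eq finite_nbrs) auto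
      moreover have "y \<in> nbrs V a" using \<open>E y a\<close> E_sym d by (auto simp: nbrs_def)
      ultimately show False using d by (auto simp: W_def)
    qed
    hence "nbrs V y \<subseteq> {b}" using d E_irrefl by (auto simp: nbrs_def W_def)
    hence "card (nbrs V y) \<le> card {b}" by (intro card_mono) auto
    thus False using degree_ge[of y] d by simp
  qed
  then obtain e w h where P3: "e \<in> W" "w \<in> W" "h \<in> W" "E e w" "E h w" "e \<noteq> h" "\<not> E e h"
    by (rule induced_path[OF cW])
  have eh: "dist2 e h" using P3 by (auto simp: dist2_def)
  have "linked x y e h" by (rule disjoint_linked[OF assms(1) eh]) (use P3 in \<open>auto simp: W_def\<close>)
  moreover have "linked e h x b" by (rule disjoint_linked[OF eh assms(2)]) (use P3 in \<open>auto simp: W_def\<close>)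
  ultimately show ?thesis by (rule linked_trans[OF eh])
qed

lemma all_linked:
  assumes "dist2 x y" "dist2 s t" shows "linked x y s t"
proof (cases "{x, y} \<inter> {s, t} = {}")
  case True
  thus ?thesis using disjoint_linked assms by blast
next
  case False
  then consider "x = s" | "x = t" | "y = s" | "y = t" by blast
  thus ?thesis
  proof cases
    case 1 thus ?thesis using shared_linked assms by blast
  next
    case 2 thus ?thesis using shared_linked[OF assms(1), of s] dist2_sym[OF assms(2)] linked_swap(2) by blast
  next
    case 3 thus ?thesis using shared_linked[of y x t] dist2_sym[OF assms(1)] assms(2) linked_swap(1) by blast
  next
    case 4
    thus ?thesis using shared_linked[of y x s] dist2_sym[OF assms(1)] dist2_sym[OF assms(2)] linked_swap by blast
  qed
qed

theorem uniform_all_equiv: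
  assumes "col \<phi>" "col \<psi>" shows "\<phi> \<approx> \<psi>"
proof -
  obtain v where v: "v \<in> V" using card_V by fastforce
  have mono: "\<exists>x y. dist2 x y \<and> \<rho> x = \<rho> y" if "col \<rho>" for \<rho>
    using that v
  proof (cases rule: exists_pattern)
    case (single x)
    thus ?thesis using singleD[OF single] L_K by blast
  next
    case (pair x y)
    have "dist2 x y" using pair(1) by (auto simp: pair_def dist2_def)
    thus ?thesis using pair(2) by metis
  qed
  obtain x y where "dist2 x y" "\<phi> x = \<phi> y" using mono[OF assms(1)] by blast
  moreover obtain s t where "dist2 s t" "\<psi> s = \<psi> t" using mono[OF assms(2)] by blast
  ultimately show ?thesis using all_linked[of x y s t] assms unfolding linked_def by blast
qed

end

context tight_lists begin

theorem tight_all_equiv: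
  assumes "col \<phi>" "col \<psi>" shows "\<phi> \<approx> \<psi>"
proof (cases "\<exists>u c v. single u c v")
  case True
  thus ?thesis using single_all_equiv assms by blast
next
  case False
  hence sub: "L u \<subseteq> L v" if "E u v" for u v using that unfolding single_def by blast
  obtain v0 where v0: "v0 \<in> V" using card_V by fastforce
  have cV: "connected_on V" using conn[of "{}"] by simp
  have "L v = L v0" if v: "v \<in> V" for v
  proof (rule ccontr)
    assume ne: "L v \<noteq> L v0"
    let ?T = "{v \<in> V. L v = L v0}"
    have T: "?T \<subseteq> V" "?T \<noteq> {}" "?T \<noteq> V" using ne v v0 by auto
    obtain a b where ab: "a \<in> ?T" "b \<in> V" "b \<notin> ?T" "E a b" by (rule connected_onD[OF cV T])
    have "L b = L a" using sub[OF ab(4)] sub[OF E_sym[OF ab(4)]] by blast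
    thus False using ab by auto
  qed
  then interpret uniform_lists V E L "L v0" by unfold_locales
  show ?thesis by (rule uniform_all_equiv[OF assms])
qed

end

subsection \<open>Kempe changes\<close>

context four_connected begin

theorem degree_lists_equiv:
  assumes L: "degree_lists V L" and c: "list_coloring V L \<phi>" "list_coloring V L \<psi>"
  shows "swap_equiv V L \<phi> \<psi>"
proof (cases "\<exists>v\<in>V. card (nbrs V v) < card (L v)")
  case True
  have "connected_on V" using conn[of "{}"] by simp
  hence "surplus_lists V L"
    using L True unfolding surplus_lists_def connected_on_def by metis
  thus ?thesis by (rule surplus_equiv[OF finite_V _ c])
next
  case False
  interpret tight_lists V E L
    using L False by unfold_locales (auto simp: degree_lists_def order.eq_iff not_less)
  show ?thesis by (rule tight_all_equiv[OF c])
qed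

text \<open>Infinite lists are cut down to finite ones that still contain the two given colorings.\<close>

theorem guarded_lists_equiv:
  assumes L: "\<And>v. v \<in> V \<Longrightarrow> finite (L v) \<Longrightarrow> card (nbrs V v) \<le> card (L v)"
    and c: "list_coloring V L \<phi>" "list_coloring V L \<psi>"
  shows "swap_equiv V L \<phi> \<psi>"
proof -
  have "\<exists>S. S \<subseteq> L v \<and> finite S \<and> card (nbrs V v) \<le> card S \<and> \<phi> v \<in> S \<and> \<psi> v \<in> S" if v: "v \<in> V" for v
  proof -
    have m: "\<phi> v \<in> L v" "\<psi> v \<in> L v" using list_coloringD(1)[OF c(1) v] list_coloringD(1)[OF c(2) v] by auto
    show ?thesis
    proof (cases "finite (L v)")
      case True
      thus ?thesis using L[OF v] m by (intro exI[of _ "L v"]) auto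
    next
      case False
      then obtain S where S: "finite S" "card S = card (nbrs V v)" "S \<subseteq> L v"
        using infinite_arbitrarily_large by blast
      have "card S \<le> card (S \<union> {\<phi> v, \<psi> v})" using S(1) by (intro card_mono) auto
      thus ?thesis using S m by (intro exI[of _ "S \<union> {\<phi> v, \<psi> v}"]) auto
    qed
  qed
  then obtain L' where L': "\<And>v. v \<in> V \<Longrightarrow> L' v \<subseteq> L v \<and> finite (L' v) \<and> card (nbrs V v) \<le> card (L' v)
      \<and> \<phi> v \<in> L' v \<and> \<psi> v \<in> L' v" by metis
  have "degree_lists V L'" using L' unfolding degree_lists_def by blast
  moreover have "list_coloring V L' \<phi>" "list_coloring V L' \<psi>"
    using L' c unfolding list_coloring_def by auto
  ultimately have "swap_equiv V L' \<phi> \<psi>" by (rule degree_lists_equiv)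
  thus ?thesis
    by (rule rtranclp_mono[THEN predicate2D, rotated]) (use swap_mono_lists[of V L' L] L' in blast)
qed

end

section \<open>Translation between adjacency relations and symmetric digraphs\<close>

context graph begin

sublocale dom: simple_graph "verts G" "dominates G"
proof unfold_locales
  show "finite (verts G)" by simp
  show "u \<in> verts G" if "u \<rightarrow>\<^bsub>G\<^esub> v" for u v using that by auto
  show "v \<rightarrow>\<^bsub>G\<^esub> u" if "u \<rightarrow>\<^bsub>G\<^esub> v" for u v by (rule arcs_ends_symmetric[OF sym_arcs that])
  show "\<not> v \<rightarrow>\<^bsub>G\<^esub> v" for v using adj_not_same by blast
qed

lemma dominates_induced: "u \<rightarrow>\<^bsub>G \<restriction> W\<^esub> v \<longleftrightarrow> u \<rightarrow>\<^bsub>G\<^esub> v \<and> u \<in> W \<and> v \<in> W"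
  by (auto simp: arcs_ends_conv)

lemma symmetric_induced: "symmetric (G \<restriction> W)"
  unfolding symmetric_def
proof (rule symI)
  fix u v assume "u \<rightarrow>\<^bsub>G \<restriction> W\<^esub> v"
  thus "v \<rightarrow>\<^bsub>G \<restriction> W\<^esub> u" using dom.E_sym[of u v] by (simp add: dominates_induced)
qed

lemma out_degree_nbrs: "out_degree G v = card (dom.nbrs (verts G) v)"
proof -
  have "dom.nbrs (verts G) v = head G ` out_arcs G v"
    unfolding dom.nbrs_def by (auto simp: arcs_ends_conv)
  moreover have "inj_on (head G) (out_arcs G v)"
    by (rule inj_onI) (auto intro!: no_multi_arcs simp: arc_to_ends_def)
  ultimately show ?thesis by (simp add: out_degree_def card_image)
qed

lemma connected_induced:
  assumes "Digraph_Component.connected (G \<restriction> W)" "W \<subseteq> verts G" shows "dom.connected_on W"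
  unfolding dom.connected_on_def
proof (intro allI impI)
  fix A assume A: "dom.closed_in W A"
  interpret H: wf_digraph "G \<restriction> W" by (rule wellformed_induce_subgraph)
  have AW: "A \<subseteq> W" using A by (simp add: dom.closed_in_def)
  show "A = {} \<or> A = W"
  proof (rule ccontr)
    assume "\<not> ?thesis"
    then obtain a b where ab: "a \<in> A" "b \<in> W - A" using AW by blast
    have "a \<rightarrow>\<^sup>*\<^bsub>mk_symmetric (G \<restriction> W)\<^esub> b"
      using assms ab AW unfolding connected_def strongly_connected_def by auto
    hence "a \<rightarrow>\<^sup>*\<^bsub>G \<restriction> W\<^esub> b" using H.reachable_mk_symmetric_eq[OF symmetric_induced] by simp
    hence "b \<in> A"
    proof (induction rule: H.reachable_induct)
      case base thus ?case using ab by simp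
    next
      case (step x y)
      thus ?case using A dominates_induced unfolding dom.closed_in_def by blast
    qed
    thus False using ab by blast
  qed
qed

lemma L_coloring_iff:
  "L_coloring G L \<phi> \<longleftrightarrow> dom.list_coloring (verts G) L \<phi> \<and> \<phi> \<in> extensional (verts G)"
  unfolding L_coloring_def dom.list_coloring_def proper_coloring_def PiE_def Pi_def
  using dom.E_V dom.E_V2 by blast

text \<open>Interchanging two colors on a union of Kempe chains is a sequence of Kempe changes, each of
  them valid because every vertex has its old or its new color throughout.\<close>

lemma closed_swap_kempe:
  assumes "L_coloring G L \<phi>" "dom.swap_closed (verts G) \<phi> a b C" "a \<noteq> b"
    and "\<And>v. v \<in> C \<Longrightarrow> transpose a b (\<phi> v) \<in> L v"
  shows "L_equivalent G L \<phi> (\<lambda>v. if v \<in> C then transpose a b (\<phi> v) else \<phi> v)"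
  using assms
proof (induction "card C" arbitrary: C \<phi> rule: less_induct)
  case less
  note CD = dom.swap_closedD[OF less.prems(2)]
  show ?case
  proof (cases "C = {}")
    case True
    thus ?thesis by (simp add: L_equivalent_def)
  next
    case False
    then obtain x where x: "x \<in> C" by blast
    define U where "U = {v \<in> verts G. \<phi> v = a \<or> \<phi> v = b}"
    \<comment> \<open>One Kempe chain is peeled off; the rest \<open>C - D\<close> is smaller and
      remains closed after the change on \<open>D\<close>.\<close>
    define D where "D = pre_digraph.scc_of (G \<restriction> U) x"
    interpret H: wf_digraph "G \<restriction> U" by (rule wellformed_induce_subgraph)
    have xU: "x \<in> U" using CD(1,2)[OF x] by (auto simp: U_def)
    have Dmem: "u \<in> D \<longleftrightarrow> x \<rightarrow>\<^sup>*\<^bsub>G \<restriction> U\<^esub> u" for u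
      unfolding D_def H.scc_of_def using symmetric_reachable[OF symmetric_induced] by auto
    have DU: "D \<subseteq> U" using Dmem H.reachable_in_verts(2) by fastforce
    have DC: "D \<subseteq> C"
    proof
      fix u assume "u \<in> D"
      hence "x \<rightarrow>\<^sup>*\<^bsub>G \<restriction> U\<^esub> u" using Dmem by blast
      thus "u \<in> C"
      proof (induction rule: H.reachable_induct)
        case base show ?case by (rule x)
      next
        case (step y z)
        have "y \<rightarrow>\<^bsub>G\<^esub> z" "z \<in> U" using step.hyps(2) dominates_induced by blast+
        thus ?case using CD(3)[OF step.IH, of z] by (auto simp: U_def)
      qed
    qed
    have xD: "x \<in> D" using Dmem xU by simp
    have chain: "kempe_chain G \<phi> a b D"
      unfolding kempe_chain_def D_def U_def[symmetric] using H.scc_of_in_sccs_verts xU by simp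
    have Dcl: "dom.swap_closed (verts G) \<phi> a b D"
    proof (rule dom.swap_closedI)
      fix u assume u: "u \<in> D"
      show "u \<in> verts G" "\<phi> u \<in> {a, b}" using u DU by (auto simp: U_def)
      fix v assume v: "v \<in> verts G" "u \<rightarrow>\<^bsub>G\<^esub> v" "\<phi> v \<in> {a, b}"
      have "u \<rightarrow>\<^bsub>G \<restriction> U\<^esub> v" using u v DU dominates_induced by (auto simp: U_def)
      thus "v \<in> D" using u Dmem H.reachable_adj_trans by blast
    qed
    define \<psi> where "\<psi> = (\<lambda>v. if v \<in> D then transpose a b (\<phi> v) else \<phi> v)"
    have "dom.list_coloring (verts G) L \<psi>"
      by (rule dom.list_coloring_swapped[OF _ Dcl])
        (use less.prems(1,4) DC in \<open>auto simp: L_coloring_iff \<psi>_def\<close>)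
    moreover have "\<psi> \<in> extensional (verts G)"
      using less.prems(1) DU by (auto simp: L_coloring_iff \<psi>_def extensional_def U_def)
    ultimately have psi: "L_coloring G L \<psi>" by (simp add: L_coloring_iff)
    have "kempe_change G \<phi> \<psi>" unfolding kempe_change_def using chain less.prems(3) \<psi>_def by blast
    hence "L_valid_kempe_change G L \<phi> \<psi>"
      using psi less.prems(1) by (simp add: L_valid_kempe_change_def)
    hence first: "L_equivalent G L \<phi> \<psi>" unfolding L_equivalent_def by (rule r_into_rtranclp[of "L_valid_kempe_change G L"])
    have ab: "\<psi> v \<in> {a, b} \<longleftrightarrow> \<phi> v \<in> {a, b}" if "v \<in> verts G" for v
    proof (cases "v \<in> D")
      case True
      thus ?thesis using dom.swap_closedD(2)[OF Dcl True] by (auto simp: \<psi>_def)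
    qed (simp add: \<psi>_def)
    have rest: "dom.swap_closed (verts G) \<psi> a b (C - D)"
    proof (rule dom.swap_closedI)
      fix u assume u: "u \<in> C - D"
      show uV: "u \<in> verts G" using CD(1) u by blast
      show "\<psi> u \<in> {a, b}" using CD(2)[of u] u ab[OF uV] by simp
      fix v assume v: "v \<in> verts G" "u \<rightarrow>\<^bsub>G\<^esub> v" "\<psi> v \<in> {a, b}"
      have "v \<in> C" using CD(3)[of u v] u v ab[OF v(1)] by simp
      moreover have "v \<notin> D"
        using dom.swap_closedD(3)[OF Dcl, of v u] u uV dom.E_sym[OF v(2)] CD(2)[of u] by blast
      ultimately show "v \<in> C - D" by blast
    qed
    have "finite C" using CD(1) finite_verts finite_subset by (metis subsetI)
    hence "card (C - D) < card C" using xD x by (intro psubset_card_mono) auto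
    from less.hyps[OF this psi rest less.prems(3)]
    have "L_equivalent G L \<psi> (\<lambda>v. if v \<in> C - D then transpose a b (\<psi> v) else \<psi> v)"
      using less.prems(4) by (auto simp: \<psi>_def)
    moreover have "(\<lambda>v. if v \<in> C - D then transpose a b (\<psi> v) else \<psi> v) =
        (\<lambda>v. if v \<in> C then transpose a b (\<phi> v) else \<phi> v)"
      using DC by (auto simp: \<psi>_def fun_eq_iff)
    ultimately show ?thesis using first unfolding L_equivalent_def by (metis rtranclp_trans)
  qed
qed

text \<open>Restriction restores the extensionality built into \<open>L_coloring\<close>. A swap
  with \<open>a = b\<close> is not a Kempe change, but it changes nothing.\<close>

lemma swap_kempe:
  assumes "dom.swap (verts G) L \<phi> \<psi>"
  shows "L_equivalent G L (restrict \<phi> (verts G)) (restrict \<psi> (verts G))"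
proof -
  obtain a b C where C: "dom.swap_closed (verts G) \<phi> a b C"
    and ps: "\<And>v. v \<in> verts G \<Longrightarrow> \<psi> v = (if v \<in> C then transpose a b (\<phi> v) else \<phi> v)"
    and l: "dom.list_coloring (verts G) L \<phi>" "dom.list_coloring (verts G) L \<psi>"
    using assms unfolding dom.swap_def by blast
  let ?\<phi> = "restrict \<phi> (verts G)"
  note CD = dom.swap_closedD[OF C]
  show ?thesis
  proof (cases "a = b")
    case True
    hence "restrict \<psi> (verts G) = ?\<phi>" using ps by (auto simp: restrict_def fun_eq_iff)
    thus ?thesis by (simp add: L_equivalent_def)
  next
    case False
    have lc: "L_coloring G L ?\<phi>"
      using l(1) by (simp add: L_coloring_iff dom.list_coloring_def)
    have cl: "dom.swap_closed (verts G) ?\<phi> a b C"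
    proof (rule dom.swap_closedI)
      fix u assume u: "u \<in> C"
      show "u \<in> verts G" "?\<phi> u \<in> {a, b}" using CD(1,2)[OF u] by auto
      fix v assume "v \<in> verts G" "u \<rightarrow>\<^bsub>G\<^esub> v" "?\<phi> v \<in> {a, b}"
      thus "v \<in> C" using CD(3)[OF u, of v] by simp
    qed
    have inL: "transpose a b (?\<phi> v) \<in> L v" if "v \<in> C" for v
      using ps[of v] CD(1)[OF that] that dom.list_coloringD(1)[OF l(2), of v] by simp
    have "(\<lambda>v. if v \<in> C then transpose a b (?\<phi> v) else ?\<phi> v) = restrict \<psi> (verts G)"
    proof
      fix v
      show "(if v \<in> C then transpose a b (?\<phi> v) else ?\<phi> v) = restrict \<psi> (verts G) v"
        using ps[of v] CD(1)[of v] by (cases "v \<in> verts G") auto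
    qed
    thus ?thesis using closed_swap_kempe[OF lc cl False inL] by metis
  qed
qed

lemma swap_equiv_kempe:
  assumes "dom.swap_equiv (verts G) L \<phi> \<psi>"
  shows "L_equivalent G L (restrict \<phi> (verts G)) (restrict \<psi> (verts G))"
  using assms
proof (induction rule: rtranclp_induct)
  case base
  show ?case by (simp add: L_equivalent_def)
next
  case (step \<chi> \<psi>)
  thus ?case using swap_kempe[OF step.hyps(2)] unfolding L_equivalent_def by (metis rtranclp_trans)
qed

lemma four_connected_dom:
  assumes "k_connected 4 G" "\<not> (\<exists>n. complete_digraph n G)"
  shows "four_connected (verts G) (dominates G)"
proof unfold_locales
  show "card (verts G) > 4" using assms(1) by (simp add: k_connected_def)
  show "dom.connected_on (verts G - X)" if "X \<subseteq> verts G" "card X < 4" for X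
  proof (rule connected_induced)
    have "finite X" using that(1) finite_verts finite_subset by blast
    thus "Digraph_Component.connected (G \<restriction> (verts G - X))"
      using assms(1) that unfolding k_connected_def by blast
  qed blast
  show "\<not> dom.clique (verts G)"
  proof
    assume cl: "dom.clique (verts G)"
    have "arcs_ends G = {(u, v). (u, v) \<in> verts G \<times> verts G \<and> u \<noteq> v}"
    proof (intro subset_antisym subrelI)
      fix u v assume "(u, v) \<in> arcs_ends G"
      thus "(u, v) \<in> {(u, v). (u, v) \<in> verts G \<times> verts G \<and> u \<noteq> v}"
        using dom.E_V dom.E_V2 dom.E_irrefl by blast
    next
      fix u v assume "(u, v) \<in> {(u, v). (u, v) \<in> verts G \<times> verts G \<and> u \<noteq> v}"
      thus "(u, v) \<in> arcs_ends G" using cl unfolding dom.clique_def by blast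
    qed
    hence "complete_digraph (card (verts G)) G"
      using graph_axioms by (simp add: complete_digraph_def)
    thus False using assms(2) by blast
  qed
qed

end

theorem theorem1p2:
  fixes G :: "('a, 'b) pre_digraph"
  assumes "graph G"
    and "k_connected 4 G"
    and "\<not> (\<exists>n. complete_digraph n G)"
  shows "degree_swappable TYPE('c) G"
proof -
  interpret graph G by (rule assms(1))
  interpret four: four_connected "verts G" "dominates G" by (rule four_connected_dom[OF assms(2,3)])
  show ?thesis
    unfolding degree_swappable_def
  proof (intro allI impI)
    fix L :: "'a \<Rightarrow> 'c set" and \<phi> \<psi>
    assume L: "degree_assignment G L" and c: "L_coloring G L \<phi>" "L_coloring G L \<psi>"
    have "dom.swap_equiv (verts G) L \<phi> \<psi>"
    proof (rule four.guarded_lists_equiv)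
      show "card (dom.nbrs (verts G) v) \<le> card (L v)" if "v \<in> verts G" "finite (L v)" for v
        using L that out_degree_nbrs[of v] by (auto simp: degree_assignment_def)
    qed (use c in \<open>simp_all add: L_coloring_iff\<close>)
    from swap_equiv_kempe[OF this] show "L_equivalent G L \<phi> \<psi>"
      using c by (simp add: L_coloring_iff extensional_restrict)
  qed
qed

end
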